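(* Let $I\subset\mathbb R$ be a compact interval, $\mu\ge0$, and let $H(t)$, $t\in I$, be a family of symmetric operators such that $H(t)\in\mathcal L(\mathcal H^\mu,\mathcal H)$ depends continuously (in operator norm) on $t\in I$. Suppose that the equation $\mathrm i\partial_tu(t)=H(t)u(t)$ generates a unitary propagator $U(t,s)$, $s,t\in I$, and that, for some $\sigma>0$, $U(t,s)\mathcal H^{\mu+\sigma}\subset\mathcal H^{\mu+\sigma}$ for all $s,t\in I$, with $$C_{U,\mu+\sigma}:=\sup_{s,t\in I}\|U(t,s)\|_{\mathcal L(\mathcal H^{\mu+\sigma})}<\infty .$$ Set $C_{H,\mu}:=\sup_{t\in I}\|H(t)\|_{\mathcal L(\mathcal H^\mu,\mathcal H)}$. Then for every $N>0$ and every $u\in\mathcal H^{\mu+\sigma}$, $$\sup_{s,t\in I}\|U_N(t,s)P_Nu-U(t,s)u\|\le C_{U,\mu+\sigma}\Bigl((1+N)^{-(\mu+\sigma)}+|I|\,C_{H,\mu}(1+N)^{-\sigma}\Bigr)\|u\|_{\mu+\sigma}.$$ In particular, there is a constant $C_{I,\mu,\sigma}>0$ independent of $N$ (and of $u$) such that $$\sup_{s,t\in I}\|U_N(t,s)P_Nu-U(t,s)u\|\le C_{I,\mu,\sigma}(1+N)^{-\sigma}\|u\|_{\mu+\sigma}.$$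
   Context: $\mathcal H$ is a complex separable Hilbert space and $H_0$ a positive self-adjoint operator on $\mathcal H$ with compact resolvent (spectrum contained in $[0,\infty)$). For $N>0$, $P_N=\mathbf 1_{[0,N]}(H_0)$ and $\mathcal H_N=P_N\mathcal H$ (finite-dimensional). For $r\ge0$, $\mathcal H^r=D((1+H_0)^r)$ with norm $\|u\|_r=\|(1+H_0)^ru\|$. $|I|$ is the length of $I$. $H_N(t)=P_NH(t)P_N$ is viewed as a self-adjoint operator on $\mathcal H_N$, and $U_N(t,s)$ is its unitary propagator: $\mathrm i\partial_tU_N(t,s)=H_N(t)U_N(t,s)$, $U_N(s,s)=\mathbf 1_{\mathcal H_N}$. "Generates a unitary propagator" means: the $U(t,s)$ are unitary on $\mathcal H$, strongly continuous in $(t,s)$, satisfy $U(t,r)U(r,s)=U(t,s)$, $U(s,s)=\mathbf 1$, and for $u\in\mathcal H^{\mu+\sigma}$ the function $t\mapsto U(t,s)u$ is a strong solution of $\mathrm i\partial_tu(t)=H(t)u(t)$ in $\mathcal H$. *)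

theory Defs
  imports "HOL-Analysis.Analysis"
begin

section \<open>Complex Hilbert spaces\<close>

text \<open>The form \<open>cinner\<close> is antilinear in its first argument. Definiteness and compatibility
  with the norm come from the superclass, whose inner product is the real part of \<open>cinner\<close>.\<close>

class complex_inner = real_inner +
  fixes scaleC :: "complex \<Rightarrow> 'a \<Rightarrow> 'a" (infixr \<open>*\<^sub>C\<close> 75)
    and cinner :: "'a \<Rightarrow> 'a \<Rightarrow> complex"
  assumes scaleC_add_right: "c *\<^sub>C (x + y) = c *\<^sub>C x + c *\<^sub>C y"
    and scaleC_add_left: "(c + d) *\<^sub>C x = c *\<^sub>C x + d *\<^sub>C x"
    and scaleC_scaleC: "c *\<^sub>C (d *\<^sub>C x) = (c * d) *\<^sub>C x"
    and scaleC_of_real: "complex_of_real r *\<^sub>C x = r *\<^sub>R x"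
    and cinner_commute: "cinner x y = cnj (cinner y x)"
    and cinner_add_right: "cinner x (y + z) = cinner x y + cinner x z"
    and cinner_scaleC_right: "cinner x (c *\<^sub>C y) = c * cinner x y"
    and inner_eq_Re_cinner: "inner x y = Re (cinner x y)"

class chilbert_space = complex_inner + banach

definition csubspace :: "'a::complex_inner set \<Rightarrow> bool" where
  "csubspace S \<longleftrightarrow>
     0 \<in> S \<and> (\<forall>x\<in>S. \<forall>y\<in>S. x + y \<in> S) \<and> (\<forall>c. \<forall>x\<in>S. c *\<^sub>C x \<in> S)"

definition clinear_on :: "'a::complex_inner set \<Rightarrow> ('a \<Rightarrow> 'a) \<Rightarrow> bool" where
  "clinear_on S T \<longleftrightarrow> csubspace S \<and>
     (\<forall>x\<in>S. \<forall>y\<in>S. T (x + y) = T x + T y) \<and> (\<forall>c. \<forall>x\<in>S. T (c *\<^sub>C x) = c *\<^sub>C T x)"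

definition orth_proj :: "'a::complex_inner set \<Rightarrow> 'a \<Rightarrow> 'a" where
  "orth_proj S u = (THE v. v \<in> S \<and> (\<forall>w\<in>S. cinner w (u - v) = 0))"


section \<open>Unbounded operators\<close>

text \<open>An unbounded operator is given by its domain \<open>D\<close> and a function \<open>A\<close>, of which only the
  values on \<open>D\<close> matter.\<close>

definition symmetric_on :: "'a::complex_inner set \<Rightarrow> ('a \<Rightarrow> 'a) \<Rightarrow> bool" where
  "symmetric_on D A \<longleftrightarrow> (\<forall>u\<in>D. \<forall>v\<in>D. cinner (A u) v = cinner u (A v))"

text \<open>The last conjunct says that \<open>A\<close> and its adjoint have the same graph.\<close>

definition self_adjoint :: "'a::complex_inner set \<Rightarrow> ('a \<Rightarrow> 'a) \<Rightarrow> bool" where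
  "self_adjoint D A \<longleftrightarrow> clinear_on D A \<and> closure D = UNIV \<and>
     (\<forall>v w. (v \<in> D \<and> w = A v) \<longleftrightarrow> (\<forall>u\<in>D. cinner (A u) v = cinner u w))"

definition positive_on :: "'a::complex_inner set \<Rightarrow> ('a \<Rightarrow> 'a) \<Rightarrow> bool" where
  "positive_on D A \<longleftrightarrow> (\<forall>u\<in>D. 0 \<le> Re (cinner u (A u)))"

definition resolvent :: "'a::complex_inner set \<Rightarrow> ('a \<Rightarrow> 'a) \<Rightarrow> complex \<Rightarrow> 'a \<Rightarrow> 'a" where
  "resolvent D A z = inv_into D (\<lambda>u. A u - z *\<^sub>C u)"

definition resolvent_set :: "'a::complex_inner set \<Rightarrow> ('a \<Rightarrow> 'a) \<Rightarrow> complex set" where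
  "resolvent_set D A =
     {z. bij_betw (\<lambda>u. A u - z *\<^sub>C u) D UNIV \<and> bounded_linear (resolvent D A z)}"

definition compact_resolvent :: "'a::complex_inner set \<Rightarrow> ('a \<Rightarrow> 'a) \<Rightarrow> bool" where
  "compact_resolvent D A \<longleftrightarrow>
     (\<exists>z\<in>resolvent_set D A. compact (closure (resolvent D A z ` cball 0 1)))"


section \<open>Functional calculus\<close>

text \<open>For a self-adjoint operator with compact resolvent the spectrum consists of (real)
  eigenvalues and the spectral measure of a Borel set is the sum of the orthogonal projections
  onto the eigenspaces of the eigenvalues in that set. So \<open>f(A) u\<close> is the sum over the
  eigenvalues \<open>l\<close> of \<open>f(l)\<close> times the projection of \<open>u\<close> onto the eigenspace of \<open>l\<close>, for those
  \<open>u\<close> for which the squared norms of the terms are summable.\<close>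

definition eigenspace :: "'a::complex_inner set \<Rightarrow> ('a \<Rightarrow> 'a) \<Rightarrow> real \<Rightarrow> 'a set" where
  "eigenspace D A l = {u \<in> D. A u = l *\<^sub>R u}"

definition eigenvalues :: "'a::complex_inner set \<Rightarrow> ('a \<Rightarrow> 'a) \<Rightarrow> real set" where
  "eigenvalues D A = {l. \<exists>u\<in>eigenspace D A l. u \<noteq> 0}"

definition fcalc_dom :: "'a::complex_inner set \<Rightarrow> ('a \<Rightarrow> 'a) \<Rightarrow> (real \<Rightarrow> real) \<Rightarrow> 'a set" where
  "fcalc_dom D A f =
     {u. (\<lambda>l. (norm (f l *\<^sub>R orth_proj (eigenspace D A l) u))\<^sup>2) summable_on eigenvalues D A}"

definition fcalc :: "'a::complex_inner set \<Rightarrow> ('a \<Rightarrow> 'a) \<Rightarrow> (real \<Rightarrow> real) \<Rightarrow> 'a \<Rightarrow> 'a" where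
  "fcalc D A f u = (\<Sum>\<^sub>\<infinity>l\<in>eigenvalues D A. f l *\<^sub>R orth_proj (eigenspace D A l) u)"

definition spec_proj :: "'a::complex_inner set \<Rightarrow> ('a \<Rightarrow> 'a) \<Rightarrow> real \<Rightarrow> 'a \<Rightarrow> 'a" where
  "spec_proj D A N = fcalc D A (indicator {0..N})"

text \<open>The spaces \<open>D((1 + A)^r)\<close> and their norms.\<close>

definition Hsp :: "'a::complex_inner set \<Rightarrow> ('a \<Rightarrow> 'a) \<Rightarrow> real \<Rightarrow> 'a set" where
  "Hsp D A r = fcalc_dom D A (\<lambda>l. (1 + l) powr r)"

definition Hnorm :: "'a::complex_inner set \<Rightarrow> ('a \<Rightarrow> 'a) \<Rightarrow> real \<Rightarrow> 'a \<Rightarrow> real" where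
  "Hnorm D A r u = norm (fcalc D A (\<lambda>l. (1 + l) powr r) u)"


section \<open>Operator norms\<close>

text \<open>Here \<open>T\<close> maps \<open>X\<close>, normed by \<open>nX\<close>, into a space normed by \<open>nY\<close>. The norm
  takes values in \<open>[0, \<infinity>]\<close>, so that it is the genuine supremum also for unbounded \<open>T\<close>.\<close>

definition op_norm :: "'a::complex_inner set \<Rightarrow> ('a \<Rightarrow> real) \<Rightarrow> ('a \<Rightarrow> real) \<Rightarrow> ('a \<Rightarrow> 'a) \<Rightarrow> ennreal" where
  "op_norm X nX nY T = (SUP u\<in>{u \<in> X. nX u \<le> 1}. ennreal (nY (T u)))"

definition bounded_op :: "'a::complex_inner set \<Rightarrow> ('a \<Rightarrow> real) \<Rightarrow> ('a \<Rightarrow> real) \<Rightarrow> ('a \<Rightarrow> 'a) \<Rightarrow> bool" where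
  "bounded_op X nX nY T \<longleftrightarrow> clinear_on X T \<and> op_norm X nX nY T < \<infinity>"


section \<open>Propagators\<close>

definition strong_solution ::
    "real set \<Rightarrow> 'a::complex_inner set \<Rightarrow> (real \<Rightarrow> 'a \<Rightarrow> 'a) \<Rightarrow> (real \<Rightarrow> 'a) \<Rightarrow> bool" where
  "strong_solution I X G x \<longleftrightarrow>
     (\<forall>t\<in>I. x t \<in> X \<and>
        (\<exists>x'. (x has_vector_derivative x') (at t within I) \<and> \<i> *\<^sub>C x' = G t (x t)))"

definition unitary_on :: "'a::complex_inner set \<Rightarrow> ('a \<Rightarrow> 'a) \<Rightarrow> bool" where
  "unitary_on V T \<longleftrightarrow>
     clinear_on V T \<and> T ` V = V \<and> (\<forall>u\<in>V. \<forall>v\<in>V. cinner (T u) (T v) = cinner u v)"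

text \<open>\<open>U\<close> is a unitary propagator on the closed subspace \<open>V\<close> generated by the operators \<open>G t\<close>
  with domain \<open>X\<close>; the differential equation holds for initial data in \<open>Y\<close>.\<close>

definition unitary_propagator ::
    "real set \<Rightarrow> 'a::complex_inner set \<Rightarrow> 'a set \<Rightarrow> 'a set \<Rightarrow> (real \<Rightarrow> 'a \<Rightarrow> 'a)
      \<Rightarrow> (real \<Rightarrow> real \<Rightarrow> 'a \<Rightarrow> 'a) \<Rightarrow> bool" where
  "unitary_propagator I V X Y G U \<longleftrightarrow>
     (\<forall>t\<in>I. \<forall>s\<in>I. unitary_on V (U t s)) \<and>
     (\<forall>u\<in>V. continuous_on (I \<times> I) (\<lambda>(t, s). U t s u)) \<and>
     (\<forall>t\<in>I. \<forall>r\<in>I. \<forall>s\<in>I. \<forall>u\<in>V. U t r (U r s u) = U t s u) \<and>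
     (\<forall>s\<in>I. \<forall>u\<in>V. U s s u = u) \<and>
     (\<forall>s\<in>I. \<forall>u\<in>Y. strong_solution I X G (\<lambda>t. U t s u))"

text \<open>The propagator of \<open>P\<^sub>N H(t) P\<^sub>N\<close> on the range of \<open>P\<^sub>N\<close>. Its values on that range are
  uniquely determined for times in \<open>I\<close>; all other values are irrelevant.\<close>

definition galerkin_propagator ::
    "'a::complex_inner set \<Rightarrow> ('a \<Rightarrow> 'a) \<Rightarrow> real set \<Rightarrow> (real \<Rightarrow> 'a \<Rightarrow> 'a) \<Rightarrow> real
      \<Rightarrow> real \<Rightarrow> real \<Rightarrow> 'a \<Rightarrow> 'a" where
  "galerkin_propagator D A I H N =
     (let P = spec_proj D A N; V = range P
      in SOME W. unitary_propagator I V V V (\<lambda>t u. P (H t (P u))) W)"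

end

(* The error splits as (U_N(t,s) P_N u - P_N v(t)) - (1 - P_N) v(t), where v(t) = U(t,s) u.
   The second term is controlled by the spectral gap: on the range of 1 - P_N, 1 + H_0 is at
   least 1 + N. The first term, e, satisfies i e' = H_N e + P_N H (1 - P_N) v up to sign; as
   H_N is symmetric, only the last summand enters the derivative of |e|^2, so |e| grows at
   most at the rate C_H (1 + N)^(-sigma) |v|_(mu + sigma).

   Both the spectral gap estimate and Hnorm being a norm need completeness of the eigenspaces
   of H_0. It follows from the variational construction of an eigenvector of the compact positive
   operator (1 + H_0)^(-1) on the orthogonal complement of all eigenspaces. That P_N H(t) P_N
   has a unitary propagator (the SOME in its definition is not vacuous) follows from Picard
   iteration, P_N H(t) P_N being bounded and norm continuous in t. *)

theory Submission
  imports Defs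
begin

section \<open>Complex inner product spaces\<close>

text \<open>The functional calculus is a sum over eigenspaces, so vectors are handled through their
  coefficients \<open>Pr l u\<close>: once completeness is known, equalities are checked and scale
  norms compared one eigenvalue at a time. Compactness is assumed at an arbitrary, possibly non-real
  point of the resolvent set, whereas the variational argument wants a symmetric nonnegative
  operator; hence the passage to the point -1.

  The choice of e matters. For v - U_N P_N u the residual would be (1 - P_N) H U_N P_N u, and
  nothing makes this small, since the Galerkin solution has no regularity uniform in N. Projecting v
  first moves the residual onto the tail (1 - P_N) v of the exact solution, whose regularity is
  propagated with constant C_U. In this residual \<open>H t\<close> consumes the exponent \<mu>, so
  only (1 + N)^(-sigma) remains, multiplied by C_H and, after integration, by |I|. The separate term
  (1 - P_N) v is measured in the plain norm and keeps the full exponent \<mu> + \<sigma>.\<close>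

lemma scaleC_zero_left [simp]: "0 *\<^sub>C (x::'a::complex_inner) = 0"
  using scaleC_of_real[of 0 x] by simp

lemma scaleC_one [simp]: "1 *\<^sub>C (x::'a::complex_inner) = x"
  using scaleC_of_real[of 1 x] by simp

lemma scaleC_zero_right [simp]: "c *\<^sub>C (0::'a::complex_inner) = 0"
  using scaleC_scaleC[of c 0 "0::'a"] by simp

lemma scaleC_minus_left: "(- c) *\<^sub>C (x::'a::complex_inner) = - (c *\<^sub>C x)"
  using scaleC_add_left[of c "-c" x] by (simp add: eq_neg_iff_add_eq_0 add.commute)

lemma scaleC_minus_right: "c *\<^sub>C (- x::'a::complex_inner) = - (c *\<^sub>C x)"
  using scaleC_add_right[of c x "-x"] by (simp add: eq_neg_iff_add_eq_0 add.commute)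

lemma scaleC_diff_right: "c *\<^sub>C (x - y::'a::complex_inner) = c *\<^sub>C x - c *\<^sub>C y"
  using scaleC_add_right[of c x "-y"] by (simp add: scaleC_minus_right)

lemma scaleC_scaleR_commute: "c *\<^sub>C (r *\<^sub>R x::'a::complex_inner) = r *\<^sub>R (c *\<^sub>C x)"
  by (metis scaleC_of_real scaleC_scaleC mult.commute)

lemma scaleC_i_i [simp]: "\<i> *\<^sub>C (\<i> *\<^sub>C (x::'a::complex_inner)) = - x"
  by (simp add: scaleC_scaleC scaleC_minus_left)

lemma cinner_add_left: "cinner (x + y) (z::'a::complex_inner) = cinner x z + cinner y z"
  by (metis cinner_add_right cinner_commute complex_cnj_add)

lemma cinner_scaleC_left: "cinner (c *\<^sub>C x) (y::'a::complex_inner) = cnj c * cinner x y"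
  by (metis cinner_scaleC_right cinner_commute complex_cnj_mult)

lemma cinner_scaleR_right: "cinner x (r *\<^sub>R y::'a::complex_inner) = of_real r * cinner x y"
  by (metis cinner_scaleC_right scaleC_of_real)

lemma cinner_scaleR_left: "cinner (r *\<^sub>R x) (y::'a::complex_inner) = of_real r * cinner x y"
  by (metis cinner_scaleC_left scaleC_of_real complex_cnj_complex_of_real)

lemma cinner_zero_right [simp]: "cinner x (0::'a::complex_inner) = 0"
  using cinner_scaleR_right[of x 0 0] by simp

lemma cinner_minus_right: "cinner x (- y::'a::complex_inner) = - cinner x y"
  using cinner_scaleR_right[of x "-1" y] by simp

lemma cinner_diff_right: "cinner x (y - z::'a::complex_inner) = cinner x y - cinner x z"
  using cinner_add_right[of x y "-z"] by (simp add: cinner_minus_right)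

lemma Im_cinner: "Im (cinner x y) = inner (\<i> *\<^sub>C x) (y::'a::complex_inner)"
  by (simp add: inner_eq_Re_cinner cinner_scaleC_left)

text \<open>Recovering the complex form from the real one lets projections, limits and derivatives
  be treated in the real inner product space underneath.\<close>

lemma cinner_eq_Complex: "cinner x y = Complex (inner x y) (inner (\<i> *\<^sub>C x) (y::'a::complex_inner))"
  by (simp add: complex_eq_iff Im_cinner inner_eq_Re_cinner[symmetric])

lemma inner_i_left: "inner (\<i> *\<^sub>C x) (y::'a::complex_inner) = - inner x (\<i> *\<^sub>C y)"
  by (simp add: inner_eq_Re_cinner cinner_scaleC_left cinner_scaleC_right)

lemma inner_i_i [simp]: "inner (\<i> *\<^sub>C x) (\<i> *\<^sub>C (y::'a::complex_inner)) = inner x y"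
  by (simp add: inner_i_left)

lemma norm_i [simp]: "norm (\<i> *\<^sub>C (x::'a::complex_inner)) = norm x"
  by (simp add: norm_eq_sqrt_inner)

lemma continuous_on_cinner_right: "continuous_on UNIV (cinner (x::'a::complex_inner))"
proof -
  have "cinner x = (\<lambda>y. Complex (inner x y) (inner (\<i> *\<^sub>C x) y))"
    using cinner_eq_Complex by blast
  then show ?thesis
    by (simp only:) (intro continuous_on_Complex continuous_intros)
qed

lemma norm_cinner_self: "cinner x (x::'a::complex_inner) = of_real ((norm x)\<^sup>2)"
proof -
  have "inner (\<i> *\<^sub>C x) x = 0"
    using inner_i_left[of x x] by (simp add: inner_commute)
  then show ?thesis
    by (simp add: cinner_eq_Complex complex_eq_iff power2_norm_eq_inner)
qed

lemma norm_scaleC: "norm (c *\<^sub>C (x::'a::complex_inner)) = cmod c * norm x"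
proof -
  have "complex_of_real ((norm (c *\<^sub>C x))\<^sup>2) = of_real ((cmod c * norm x)\<^sup>2)"
    unfolding norm_cinner_self[symmetric] power_mult_distrib of_real_mult
    by (simp add: cinner_scaleC_left cinner_scaleC_right flip: complex_norm_square)

  then have "(norm (c *\<^sub>C x))\<^sup>2 = (cmod c * norm x)\<^sup>2" by (simp only: of_real_eq_iff)
  then show ?thesis by (rule power2_eq_imp_eq) simp_all
qed

lemma bounded_linear_scaleC: "bounded_linear (\<lambda>x::'a::complex_inner. c *\<^sub>C x)"
  by (rule bounded_linear_intro[where K="cmod c"])
     (simp_all add: scaleC_add_right scaleC_scaleR_commute norm_scaleC)

lemma csubspace_scaleR: "csubspace S \<Longrightarrow> x \<in> S \<Longrightarrow> r *\<^sub>R x \<in> S"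
  by (simp add: csubspace_def flip: scaleC_of_real)

lemma csubspace_imp_subspace: "csubspace S \<Longrightarrow> subspace S"
  using csubspace_scaleR[of S] by (simp add: subspace_def csubspace_def)

lemma csubspace_diff: "csubspace S \<Longrightarrow> x \<in> S \<Longrightarrow> y \<in> S \<Longrightarrow> x - y \<in> S"
  using csubspace_imp_subspace subspace_diff by blast

lemma csubspace_scaleC: "csubspace S \<Longrightarrow> x \<in> S \<Longrightarrow> c *\<^sub>C x \<in> S"
  by (simp add: csubspace_def)

text \<open>A complex subspace contains \<open>\<i> *\<^sub>C w\<close> along with \<open>w\<close>,
  and pairing with that vector gives the imaginary part. Thus the real projection theorem serves
  \<open>orth_proj\<close>.\<close>

lemma cinner_orth_iff_inner:
  assumes "csubspace S"
  shows "(\<forall>w\<in>S. cinner w z = 0) \<longleftrightarrow> (\<forall>w\<in>S. inner w z = 0)"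
  using assms csubspace_scaleC[OF assms]
  by (auto simp: cinner_eq_Complex complex_eq_iff)

section \<open>Orthogonal projections and orthogonal sums\<close>

text \<open>A sequence minimising the distance to \<open>u\<close> is Cauchy by the parallelogram
  identity; at the minimiser no displacement within \<open>S\<close> can shorten the residual, which
  forces orthogonality.\<close>

lemma Hilbert_projection_exists:
  fixes S :: "'a::{real_inner,banach} set"
  assumes S: "subspace S" "closed S"
  shows "\<exists>v\<in>S. \<forall>w\<in>S. inner w (u - v) = 0"
proof -
  define d where "d = (INF v\<in>S. (norm (u - v))\<^sup>2)"
  have ne: "S \<noteq> {}" using subspace_0[OF S(1)] by blast
  have bdd: "bdd_below ((\<lambda>v. (norm (u - v))\<^sup>2) ` S)"
    by (auto intro!: bdd_belowI[where m=0])
  have d_le: "d \<le> (norm (u - v))\<^sup>2" if "v \<in> S" for v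
    unfolding d_def by (rule cINF_lower[OF bdd that])
  have "\<exists>v\<in>S. (norm (u - v))\<^sup>2 < d + 1 / real (Suc n)" for n
    using cINF_less_iff[OF ne bdd, of "d + 1 / real (Suc n)"] by (simp add: d_def)
  then obtain v where v: "\<And>n. v n \<in> S" "\<And>n. (norm (u - v n))\<^sup>2 < d + 1 / real (Suc n)"
    by metis
  \<comment> \<open>Parallelogram identity: the midpoint of \<open>x\<close> and \<open>y\<close>
    lies in \<open>S\<close>, so its squared distance is at least \<open>d\<close>.\<close>
  have par: "(norm (x - y))\<^sup>2 \<le> 2 * (norm (u - x))\<^sup>2 + 2 * (norm (u - y))\<^sup>2 - 4 * d"
    if "x \<in> S" "y \<in> S" for x y
  proof -
    have "(1/2) *\<^sub>R (x + y) \<in> S"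
      using that S(1) by (simp add: subspace_add subspace_scale)
    from d_le[OF this] have "d \<le> (norm (u - (1/2) *\<^sub>R (x + y)))\<^sup>2" .
    moreover have "4 * (norm (u - (1/2) *\<^sub>R (x + y)))\<^sup>2
        = 2 * (norm (u - x))\<^sup>2 + 2 * (norm (u - y))\<^sup>2 - (norm (x - y))\<^sup>2"
      by (simp add: power2_norm_eq_inner inner_diff_left inner_diff_right inner_add_left
          inner_add_right inner_commute algebra_simps)
    ultimately show ?thesis by linarith
  qed
  have "Cauchy v"
  proof (rule metric_CauchyI)
    fix e :: real assume e: "0 < e"
    obtain M where M: "1 / real (Suc M) < e\<^sup>2 / 4"
      using nat_approx_posE[of "e\<^sup>2 / 4"] e by auto
    have "dist (v m) (v n) < e" if "m \<ge> M" "n \<ge> M" for m n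
    proof -
      have inv: "1 / real (Suc k) \<le> 1 / real (Suc M)" if "k \<ge> M" for k
        using that by (simp add: frac_le)
      have "(norm (v m - v n))\<^sup>2 < e\<^sup>2"
        using par[OF v(1) v(1), of m n] v(2)[of m] v(2)[of n] inv[OF that(1)] inv[OF that(2)] M
        by linarith
      then show ?thesis
        using e by (simp add: dist_norm power_less_imp_less_base)
    qed
    then show "\<exists>M. \<forall>m\<ge>M. \<forall>n\<ge>M. dist (v m) (v n) < e" by blast
  qed
  then obtain p where p: "v \<longlonglongrightarrow> p"
    using Cauchy_convergent convergent_def by blast
  have pS: "p \<in> S"
    using closed_sequentially[OF S(2)] v(1) p by blast
  have "(\<lambda>n. (norm (u - v n))\<^sup>2) \<longlonglongrightarrow> (norm (u - p))\<^sup>2"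
    by (intro tendsto_intros p)
  moreover have "(\<lambda>n. d + 1 / real (Suc n)) \<longlonglongrightarrow> d + 0"
    by (intro tendsto_intros LIMSEQ_inverse_real_of_nat[unfolded inverse_eq_divide])
  ultimately have "(norm (u - p))\<^sup>2 \<le> d + 0"
    by (rule LIMSEQ_le) (use v(2) in \<open>auto intro: less_imp_le\<close>)
  then have pd: "(norm (u - p))\<^sup>2 \<le> (norm (u - v))\<^sup>2" if "v \<in> S" for v
    using d_le[OF that] by linarith
  have "inner w (u - p) = 0" if w: "w \<in> S" for w
  proof (cases "w = 0")
    case False
    \<comment> \<open>The displacement along \<open>w\<close> that would shorten the residual
      most.\<close>
    define c where "c = inner w (u - p) / inner w w"
    have "p + c *\<^sub>R w \<in> S"
      using pS w S(1) by (simp add: subspace_add subspace_scale)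
    from pd[OF this] have "(norm (u - p))\<^sup>2 \<le> (norm ((u - p) - c *\<^sub>R w))\<^sup>2"
      by (simp add: algebra_simps)
    also have "\<dots> = (norm (u - p))\<^sup>2 + c\<^sup>2 * inner w w - 2 * (c * inner w (u - p))"
      unfolding power2_norm_eq_inner inner_diff_left[of "u - p"] inner_diff_right[of _ "u - p"]
      by (simp add: inner_commute power2_eq_square)
    finally have "0 \<le> c\<^sup>2 * inner w w - 2 * (c * inner w (u - p))" by simp
    moreover have "c * inner w w = inner w (u - p)"
      using False by (simp add: c_def)
    then have "c\<^sup>2 * inner w w = c * inner w (u - p)"
      by (simp add: power2_eq_square mult.assoc)
    ultimately have "c * inner w (u - p) \<le> 0" by linarith
    then have "(inner w (u - p))\<^sup>2 / inner w w \<le> 0"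
      by (simp add: c_def power2_eq_square)
    then have "(inner w (u - p))\<^sup>2 \<le> 0"
      using False zero_less_norm_iff[of w] by (simp add: divide_le_0_iff power2_norm_eq_inner[symmetric])
    then show ?thesis by (simp only: power2_less_eq_zero_iff)
  qed simp
  with pS show ?thesis by blast
qed

text \<open>Two candidates differ by a vector of \<open>S\<close> that is orthogonal to itself; this
  uniqueness is what gives the \<open>THE\<close> in \<open>orth_proj\<close> its value.\<close>

lemma orth_proj_eqI:
  fixes S :: "'a::complex_inner set"
  assumes S: "csubspace S" and v: "v \<in> S" "\<And>w. w \<in> S \<Longrightarrow> cinner w (u - v) = 0"
  shows "orth_proj S u = v"
  unfolding orth_proj_def
proof (rule the_equality)
  show "v \<in> S \<and> (\<forall>w\<in>S. cinner w (u - v) = 0)" using v by blast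
next
  fix x assume x: "x \<in> S \<and> (\<forall>w\<in>S. cinner w (u - x) = 0)"
  then have "x - v \<in> S" using csubspace_diff[OF S] v by blast
  with x v have "cinner (x - v) (u - v) - cinner (x - v) (u - x) = 0" by auto
  then have "cinner (x - v) (x - v) = 0"
    by (simp add: cinner_diff_right algebra_simps)
  then show "x = v" by (simp add: norm_cinner_self)
qed

lemma orth_proj:
  fixes S :: "'a::chilbert_space set"
  assumes S: "csubspace S" "closed S"
  shows "orth_proj S u \<in> S" and "w \<in> S \<Longrightarrow> cinner w (u - orth_proj S u) = 0"
proof -
  obtain v where v: "v \<in> S" "\<forall>w\<in>S. inner w (u - v) = 0"
    using Hilbert_projection_exists[OF csubspace_imp_subspace[OF S(1)] S(2)] by blast
  then have *: "\<forall>w\<in>S. cinner w (u - v) = 0"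
    using cinner_orth_iff_inner[OF S(1)] by blast
  then have "orth_proj S u = v" using orth_proj_eqI[OF S(1)] v by blast
  then show "orth_proj S u \<in> S" and "w \<in> S \<Longrightarrow> cinner w (u - orth_proj S u) = 0"
    using v * by auto
qed

lemma norm_sum_orthogonal:
  fixes v :: "'i \<Rightarrow> 'a::real_inner"
  assumes "finite F" and "\<And>i j. i \<in> F \<Longrightarrow> j \<in> F \<Longrightarrow> i \<noteq> j \<Longrightarrow> inner (v i) (v j) = 0"
  shows "(norm (sum v F))\<^sup>2 = (\<Sum>i\<in>F. (norm (v i))\<^sup>2)"
proof -
  have "inner (sum v F) (sum v F) = (\<Sum>i\<in>F. \<Sum>j\<in>F. if j = i then inner (v i) (v i) else 0)"
    unfolding inner_sum_left inner_sum_right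
    by (intro sum.cong refl) (use assms(2) in auto)
  also have "\<dots> = (\<Sum>i\<in>F. inner (v i) (v i))"
    using assms(1) by simp
  finally show ?thesis by (simp add: power2_norm_eq_inner)
qed

text \<open>By Pythagoras the squared distance of two nested partial sums is the difference of the
  sums of squares, so the Cauchy property passes from the squares to the vectors.\<close>

lemma summable_on_orthogonal:
  fixes v :: "'i \<Rightarrow> 'a::{real_inner,banach}"
  assumes orth: "\<And>i j. i \<in> A \<Longrightarrow> j \<in> A \<Longrightarrow> i \<noteq> j \<Longrightarrow> inner (v i) (v j) = 0"
    and summ: "(\<lambda>i. (norm (v i))\<^sup>2) summable_on A"
  shows "v summable_on A"
proof -
  define g where "g i = (norm (v i))\<^sup>2" for i
  obtain L where L: "(sum g \<longlongrightarrow> L) (finite_subsets_at_top A)"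
    using summ unfolding has_sum_def summable_on_def g_def by blast
  have dist_mono: "(dist (sum v F) (sum v F'))\<^sup>2 = sum g F - sum g F'"
    if "finite F" "F \<subseteq> A" "F' \<subseteq> F" for F F'
  proof -
    have "(dist (sum v F) (sum v F'))\<^sup>2 = (norm (sum v (F - F')))\<^sup>2"
      using that by (simp add: dist_norm sum_diff)
    also have "\<dots> = sum g (F - F')"
      unfolding g_def using that by (intro norm_sum_orthogonal orth) auto
    finally show ?thesis using that by (simp add: sum_diff)
  qed
  have "\<exists>P. eventually P (finite_subsets_at_top A) \<and>
              (\<forall>F F'. P F \<and> P F' \<longrightarrow> dist (sum v F) (sum v F') < e)" if "e > 0" for e
  proof -
    have "\<forall>\<^sub>F F in finite_subsets_at_top A. dist (sum g F) L < e\<^sup>2 / 8"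
      using tendstoD[OF L, of "e\<^sup>2 / 8"] that by simp
    then obtain F0 where F0: "finite F0" "F0 \<subseteq> A"
      "\<And>F. finite F \<Longrightarrow> F0 \<subseteq> F \<Longrightarrow> F \<subseteq> A \<Longrightarrow> dist (sum g F) L < e\<^sup>2 / 8"
      unfolding eventually_finite_subsets_at_top by metis
    \<comment> \<open>Two index sets need not be nested, so each is compared with \<open>F0\<close>.
      Sums of squares within \<open>e\<^sup>2 / 8\<close> of their limit differ by less than
      \<open>(e / 2)\<^sup>2\<close>.\<close>
    have near: "dist (sum v F) (sum v F0) < e / 2" if "finite F" "F0 \<subseteq> F" "F \<subseteq> A" for F
    proof -
      have "(e / 2)\<^sup>2 = e\<^sup>2 / 4" by (simp add: power_divide)
      then have "(dist (sum v F) (sum v F0))\<^sup>2 < (e / 2)\<^sup>2"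
        using dist_mono[OF that(1,3,2)] F0(3)[OF that] F0(3)[OF F0(1) order_refl F0(2)]
        unfolding dist_real_def by linarith
      then show ?thesis using \<open>e > 0\<close> by (intro power2_less_imp_less[of _ "e / 2"]) auto
    qed
    have "dist (sum v F) (sum v F') < e"
      if "finite F \<and> F0 \<subseteq> F \<and> F \<subseteq> A" "finite F' \<and> F0 \<subseteq> F' \<and> F' \<subseteq> A" for F F'
      using near[of F] near[of F'] that dist_triangle2[of "sum v F" "sum v F'" "sum v F0"]
      by linarith
    moreover have "\<forall>\<^sub>F F in finite_subsets_at_top A. finite F \<and> F0 \<subseteq> F \<and> F \<subseteq> A"
      unfolding eventually_finite_subsets_at_top by (intro exI[of _ F0]) (simp add: F0(1,2))
    ultimately show ?thesis
      by (intro exI[of _ "\<lambda>F. finite F \<and> F0 \<subseteq> F \<and> F \<subseteq> A"]) blast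
  qed
  then have "cauchy_filter (filtermap (sum v) (finite_subsets_at_top A))"
    by (simp add: cauchy_filter_metric_filtermap)
  moreover have "complete (UNIV::'a set)"
    by (meson Cauchy_convergent UNIV_I complete_def convergent_def)
  ultimately obtain L' where "(sum v \<longlongrightarrow> L') (finite_subsets_at_top A)"
    using complete_uniform[where S=UNIV] by (force simp add: filterlim_def)
  then show ?thesis
    using summable_on_def has_sum_def by blast
qed

lemma has_sum_norm_square_orthogonal:
  fixes v :: "'i \<Rightarrow> 'a::real_inner"
  assumes orth: "\<And>i j. i \<in> A \<Longrightarrow> j \<in> A \<Longrightarrow> i \<noteq> j \<Longrightarrow> inner (v i) (v j) = 0"
    and "(v has_sum x) A"
  shows "((\<lambda>i. (norm (v i))\<^sup>2) has_sum (norm x)\<^sup>2) A"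
  unfolding has_sum_def
proof (rule Lim_transform_eventually)
  show "((\<lambda>F. (norm (sum v F))\<^sup>2) \<longlongrightarrow> (norm x)\<^sup>2) (finite_subsets_at_top A)"
    using assms(2) unfolding has_sum_def by (intro tendsto_intros)
  show "\<forall>\<^sub>F F in finite_subsets_at_top A. (norm (sum v F))\<^sup>2 = (\<Sum>i\<in>F. (norm (v i))\<^sup>2)"
    by (rule eventually_finite_subsets_at_top_weakI)
       (auto intro!: norm_sum_orthogonal orth)
qed

section \<open>Completeness of the eigenspaces\<close>

text \<open>The eigenvalue is the supremum \<open>m\<close> of the quadratic form \<open>q\<close>
  on the unit ball of \<open>W\<close>. Nonnegativity of \<open>T\<close> yields
  \<open>T_le\<close>, by which \<open>T x - m *\<^sub>R x\<close> tends to zero along a maximising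
  sequence, and compactness extracts a limit.\<close>

lemma compact_positive_eigenvector:
  fixes T :: "'a::{real_inner,banach} \<Rightarrow> 'a"
  assumes T: "bounded_linear T"
    and sym: "\<And>x y. inner (T x) y = inner x (T y)"
    and pos: "\<And>x. 0 \<le> inner x (T x)"
    and W: "subspace W" "closed W" "T ` W \<subseteq> W"
    and compact: "\<And>x::nat \<Rightarrow> 'a. (\<And>n. norm (x n) \<le> 1) \<Longrightarrow> \<exists>r l. strict_mono (r::nat \<Rightarrow> nat) \<and> (\<lambda>n. T (x (r n))) \<longlonglongrightarrow> l"
    and x0: "x0 \<in> W" "T x0 \<noteq> 0"
  shows "\<exists>x\<in>W. \<exists>m>0. x \<noteq> 0 \<and> T x = m *\<^sub>R x"
proof -
  interpret T: bounded_linear T by fact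
  define q where "q x = inner x (T x)" for x
  define B where "B = {x \<in> W. norm x \<le> 1}"
  define m where "m = (SUP x\<in>B. q x)"
  have "0 \<in> B" using subspace_0[OF W(1)] by (simp add: B_def)
  obtain K where K: "\<And>x. norm (T x) \<le> norm x * K" "K \<ge> 0"
    using T.nonneg_bounded by blast
  have bdd: "bdd_above (q ` B)"
  proof (rule bdd_aboveI2)
    fix x assume "x \<in> B"
    then have "norm x \<le> 1" by (simp add: B_def)
    have "q x \<le> norm x * norm (T x)" unfolding q_def by (rule norm_cauchy_schwarz)
    also have "\<dots> \<le> 1 * (1 * K)"
      using \<open>norm x \<le> 1\<close> K(2) by (intro mult_mono order_trans[OF K(1)]) (auto intro: mult_right_mono)
    finally show "q x \<le> K" by simp
  qed
  have q_scale: "q (c *\<^sub>R x) = c\<^sup>2 * q x" for c x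
    by (simp add: q_def T.scaleR power2_eq_square)
  have q_le: "q x \<le> m * (norm x)\<^sup>2" if "x \<in> W" for x
  proof (cases "x = 0")
    case False
    have "inverse (norm x) *\<^sub>R x \<in> B"
      using that W(1) False by (simp add: B_def subspace_scale)
    then have "q (inverse (norm x) *\<^sub>R x) \<le> m"
      unfolding m_def by (rule cSUP_upper[OF _ bdd])
    then show ?thesis
      using False by (simp add: q_scale power_inverse field_simps)
  qed (simp add: q_def T.zero)
  have m0: "0 \<le> m"
    using cSUP_upper[OF \<open>0 \<in> B\<close> bdd] by (simp add: m_def q_def T.zero)
  \<comment> \<open>Nonnegativity of \<open>T\<close> tested on \<open>x - c *\<^sub>R T x\<close>.
    Below, \<open>c = 1\<close> excludes \<open>m = 0\<close> and \<open>c = 1 / m\<close> gives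
    \<open>T_le\<close>.\<close>
  have expand: "0 \<le> q x - 2 * c * (norm (T x))\<^sup>2 + c\<^sup>2 * q (T x)" for x c
  proof -
    have "0 \<le> q (x - c *\<^sub>R T x)" using pos by (simp add: q_def)
    also have "\<dots> = q x - 2 * c * (norm (T x))\<^sup>2 + c\<^sup>2 * q (T x)"
      using sym[of x "T x"]
      by (simp add: q_def T.diff T.scaleR inner_diff_left inner_diff_right power2_norm_eq_inner
          power2_eq_square[of c] algebra_simps)
    finally show ?thesis .
  qed
  have Tsq: "0 \<le> q x - 2 * c * (norm (T x))\<^sup>2 + c\<^sup>2 * (m * (norm (T x))\<^sup>2)" if "x \<in> W" for x c
  proof -
    have "c\<^sup>2 * q (T x) \<le> c\<^sup>2 * (m * (norm (T x))\<^sup>2)"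
      using q_le[of "T x"] W(3) that by (intro mult_left_mono) auto
    with expand[of x c] show ?thesis by linarith
  qed
  have "m \<noteq> 0"
  proof
    assume "m = 0"
    then have "q x0 \<le> 0" "2 * (norm (T x0))\<^sup>2 \<le> q x0"
      using Tsq[OF x0(1), of 1] q_le[OF x0(1)] by simp_all
    then have "(norm (T x0))\<^sup>2 \<le> 0" by linarith
    with x0(2) show False by simp
  qed
  with m0 have m: "0 < m" by simp
  have T_le: "(norm (T x))\<^sup>2 \<le> m * q x" if "x \<in> W" for x
  proof -
    have "(1 / m)\<^sup>2 * (m * (norm (T x))\<^sup>2) = (norm (T x))\<^sup>2 / m"
      using m by (simp add: power2_eq_square[of m] power_divide)
    then have "(norm (T x))\<^sup>2 / m \<le> q x"
      using Tsq[OF that, of "1 / m"] by simp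
    then show ?thesis using m by (simp add: divide_le_eq mult.commute)
  qed
  have "\<exists>x\<in>B. m - 1 / real (Suc n) < q x" for n
  proof -
    have "m - 1 / real (Suc n) < m" by simp
    then show ?thesis
      using less_cSUP_iff[of B q, OF _ bdd] \<open>0 \<in> B\<close> unfolding m_def by blast
  qed
  then obtain x where x: "\<And>n. x n \<in> B" "\<And>n. m - 1 / real (Suc n) < q (x n)"
    by metis
  have xW: "x n \<in> W" "norm (x n) \<le> 1" for n using x(1)[of n] by (auto simp: B_def)
  obtain r y where r: "strict_mono (r::nat \<Rightarrow> nat)" "(\<lambda>n. T (x (r n))) \<longlonglongrightarrow> y"
    using compact[of x] xW(2) by blast
  have close: "(norm (T (x n) - m *\<^sub>R x n))\<^sup>2 \<le> m * (1 / real (Suc n))" for n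
  proof -
    have "(norm (T (x n) - m *\<^sub>R x n))\<^sup>2
        = (norm (T (x n)))\<^sup>2 - 2 * m * q (x n) + m\<^sup>2 * (norm (x n))\<^sup>2"
      by (simp add: q_def power2_norm_eq_inner inner_diff_left inner_diff_right inner_commute
          power2_eq_square[of m] algebra_simps)
    also have "\<dots> \<le> m * q (x n) - 2 * m * q (x n) + m\<^sup>2 * 1"
      using T_le[OF xW(1)[of n]] xW(2)[of n] m0 by (intro add_mono diff_mono mult_left_mono power_le_one) auto
    also have "\<dots> = m * (m - q (x n))"
      by (simp add: power2_eq_square algebra_simps)
    also have "\<dots> \<le> m * (1 / real (Suc n))"
      using x(2)[of n] m by (intro mult_left_mono) auto
    finally show ?thesis .
  qed
  have "(\<lambda>n. (norm (T (x n) - m *\<^sub>R x n))\<^sup>2) \<longlonglongrightarrow> 0"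
  proof (rule tendsto_sandwich[of "\<lambda>_. 0"])
    have "(\<lambda>n. m * (1 / real (Suc n))) \<longlonglongrightarrow> m * 0"
      by (intro tendsto_intros LIMSEQ_inverse_real_of_nat[unfolded inverse_eq_divide])
    then show "(\<lambda>n. m * (1 / real (Suc n))) \<longlonglongrightarrow> 0" by simp
  qed (use close in auto)
  then have "(\<lambda>n. sqrt ((norm (T (x n) - m *\<^sub>R x n))\<^sup>2)) \<longlonglongrightarrow> sqrt 0"
    by (rule tendsto_real_sqrt)
  then have "(\<lambda>n. T (x n) - m *\<^sub>R x n) \<longlonglongrightarrow> 0"
    by (simp add: tendsto_norm_zero_iff)
  \<comment> \<open>Compactness gives convergence of the images only; the vanishing defect transfers
    it to the vectors themselves, as \<open>m\<close> is nonzero.\<close>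
  from LIMSEQ_subseq_LIMSEQ[OF this r(1)]
  have "(\<lambda>n. T (x (r n)) - m *\<^sub>R x (r n)) \<longlonglongrightarrow> 0" by (simp add: o_def)
  from tendsto_diff[OF r(2) this] have "(\<lambda>n. m *\<^sub>R x (r n)) \<longlonglongrightarrow> y" by simp
  from tendsto_scaleR[OF tendsto_const[of "inverse m"] this]
  have lim: "(\<lambda>n. x (r n)) \<longlonglongrightarrow> inverse m *\<^sub>R y" using m by simp
  define z where "z = inverse m *\<^sub>R y"
  have zW: "z \<in> W"
    unfolding z_def by (rule closed_sequentially[OF W(2) _ lim]) (simp add: xW(1))
  have Tz: "T z = m *\<^sub>R z"
    using LIMSEQ_unique[OF T.tendsto[OF lim] r(2)] m by (simp add: z_def)
  \<comment> \<open>A positive value of the form excludes the zero vector as limit. The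
    \<open>- 0\<close> matches the limit of \<open>m - 1 / real (Suc n)\<close>.\<close>
  have "m - 0 \<le> q z"
  proof (rule LIMSEQ_le)
    show "(\<lambda>n. q (x (r n))) \<longlonglongrightarrow> q z"
      unfolding q_def z_def by (intro tendsto_inner lim T.tendsto)
    have "(\<lambda>n. m - 1 / real (Suc n)) \<longlonglongrightarrow> m - 0"
      by (intro tendsto_intros LIMSEQ_inverse_real_of_nat[unfolded inverse_eq_divide])
    from LIMSEQ_subseq_LIMSEQ[OF this r(1)]
    show "(\<lambda>n. m - 1 / real (Suc (r n))) \<longlonglongrightarrow> m - 0" by (simp add: o_def)
  qed (use x(2) in \<open>auto intro: less_imp_le\<close>)
  then have "z \<noteq> 0" using m by (auto simp: q_def T.zero)
  with zW Tz m show ?thesis by blast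
qed

locale positive_compact_resolvent =
  fixes D :: "'a::chilbert_space set" and A :: "'a \<Rightarrow> 'a"
  assumes self_adjoint: "self_adjoint D A"
    and positive: "positive_on D A"
    and compact_resolvent: "compact_resolvent D A"
begin

abbreviation E :: "real \<Rightarrow> 'a set" where "E \<equiv> eigenspace D A"
abbreviation L :: "real set" where "L \<equiv> eigenvalues D A"
abbreviation Pr :: "real \<Rightarrow> 'a \<Rightarrow> 'a" where "Pr l \<equiv> orth_proj (E l)"

section \<open>The shifted operator \<open>1 + A\<close> and its inverse\<close>

lemma csubspace_D: "csubspace D"
  using self_adjoint by (simp add: self_adjoint_def clinear_on_def)

lemma A_add: "u \<in> D \<Longrightarrow> v \<in> D \<Longrightarrow> A (u + v) = A u + A v"
  using self_adjoint by (simp add: self_adjoint_def clinear_on_def)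

lemma A_scaleC: "u \<in> D \<Longrightarrow> A (c *\<^sub>C u) = c *\<^sub>C A u"
  using self_adjoint by (simp add: self_adjoint_def clinear_on_def)

lemma A_scaleR: "u \<in> D \<Longrightarrow> A (r *\<^sub>R u) = r *\<^sub>R A u"
  using A_scaleC[of u "of_real r"] by (simp add: scaleC_of_real)

lemma A_diff: "u \<in> D \<Longrightarrow> v \<in> D \<Longrightarrow> A (u - v) = A u - A v"
  using A_add[of u "(-1) *\<^sub>R v"] A_scaleR[of v "-1"] csubspace_scaleR[OF csubspace_D, of v "-1"]
  by simp

text \<open>This direction of self-adjointness produces membership in \<open>D\<close> from a weak
  equation; closedness of \<open>A\<close> and surjectivity of \<open>1 + A\<close> both rest on
  it.\<close>

lemma A_adjoint: "(\<And>u. u \<in> D \<Longrightarrow> cinner (A u) v = cinner u w) \<Longrightarrow> v \<in> D \<and> A v = w"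
  using self_adjoint unfolding self_adjoint_def by metis

lemma A_symmetric: "u \<in> D \<Longrightarrow> v \<in> D \<Longrightarrow> cinner (A u) v = cinner u (A v)"
  using self_adjoint unfolding self_adjoint_def by metis

lemma A_nonneg: "u \<in> D \<Longrightarrow> 0 \<le> inner u (A u)"
  using positive by (simp add: positive_on_def inner_eq_Re_cinner)

lemma A_closed:
  assumes "\<And>n::nat. x n \<in> D" "x \<longlonglongrightarrow> u" "(\<lambda>n. A (x n)) \<longlonglongrightarrow> w"
  shows "u \<in> D \<and> A u = w"
proof (rule A_adjoint)
  fix v assume v: "v \<in> D"
  have c: "isCont (cinner y) z" for y z :: 'a
    using continuous_on_cinner_right[of y] by (simp add: continuous_on_eq_continuous_at)
  have "(\<lambda>n. cinner (A v) (x n)) \<longlonglongrightarrow> cinner (A v) u"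
    using isCont_tendsto_compose[OF c assms(2)] .
  moreover have "(\<lambda>n. cinner (A v) (x n)) \<longlonglongrightarrow> cinner v w"
    using isCont_tendsto_compose[OF c assms(3)] A_symmetric[OF v assms(1)] by simp
  ultimately show "cinner (A v) u = cinner v w" by (rule LIMSEQ_unique)
qed

text \<open>Positivity of \<open>A\<close> makes \<open>1 + A\<close> coercive. Injectivity, closed
  range and the bound 1 on the inverse all come from this estimate.\<close>

lemma norm_le_shift:
  assumes "u \<in> D" shows "norm u \<le> norm (A u + u)"
proof (cases "u = 0")
  case False
  have "norm u * norm u \<le> inner u (A u + u)"
    using A_nonneg[OF assms] by (simp add: inner_add_right norm_eq_sqrt_inner)
  also have "\<dots> \<le> norm u * norm (A u + u)" by (rule norm_cauchy_schwarz)
  finally show ?thesis using False by simp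
qed simp

text \<open>The range is closed, by coercivity and closedness of \<open>A\<close>. A vector
  \<open>z\<close> orthogonal to it satisfies \<open>A z = - z\<close> by self-adjointness, so
  coercivity makes it vanish.\<close>

lemma shift_surj: "\<exists>u\<in>D. A u + u = y"
proof -
  define R where "R = (\<lambda>u. A u + u) ` D"
  have "0 \<in> D" using csubspace_D by (simp add: csubspace_def)
  then have "A 0 = 0" using A_scaleR[of 0 0] by simp
  have R: "csubspace R"
    unfolding csubspace_def
  proof (intro conjI ballI allI)
    show "0 \<in> R" using \<open>0 \<in> D\<close> \<open>A 0 = 0\<close> unfolding R_def by force
    show "x + y \<in> R" if xy: "x \<in> R" "y \<in> R" for x y
    proof -
      obtain u v where u: "u \<in> D" "v \<in> D" "x = A u + u" "y = A v + v"
        using xy unfolding R_def by blast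
      then have "u + v \<in> D" "x + y = A (u + v) + (u + v)"
        using csubspace_D by (auto simp: A_add csubspace_def)
      then show ?thesis unfolding R_def by blast
    qed
    show "c *\<^sub>C x \<in> R" if xy: "x \<in> R" for c x
    proof -
      obtain u where u: "u \<in> D" "x = A u + u"
        using xy unfolding R_def by blast
      then have "c *\<^sub>C u \<in> D" "c *\<^sub>C x = A (c *\<^sub>C u) + c *\<^sub>C u"
        using csubspace_D by (auto simp: A_scaleC csubspace_def scaleC_add_right)
      then show ?thesis unfolding R_def by blast
    qed
  qed
  have "closed R"
    unfolding closed_sequential_limits
  proof (intro allI impI, elim conjE)
    fix y l assume "\<forall>n. y n \<in> R" and l: "y \<longlonglongrightarrow> l"
    then have "\<forall>n. \<exists>u. u \<in> D \<and> y n = A u + u" by (auto simp: R_def)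
    then obtain u where u: "\<And>n. u n \<in> D" "\<And>n. y n = A (u n) + u n" by metis
    have le: "dist (u m) (u n) \<le> dist (y m) (y n)" for m n
      using norm_le_shift[of "u m - u n"] csubspace_diff[OF csubspace_D u(1) u(1)]
      by (simp add: dist_norm u A_diff algebra_simps)
    have "Cauchy u"
      using LIMSEQ_imp_Cauchy[OF l] le unfolding Cauchy_def by (meson le_less_trans)
    then obtain p where p: "u \<longlonglongrightarrow> p" using Cauchy_convergent convergent_def by blast
    have "(\<lambda>n. A (u n)) \<longlonglongrightarrow> l - p"
      using tendsto_diff[OF l p] by (simp add: u)
    with A_closed[OF u(1) p] have "p \<in> D \<and> A p = l - p" by blast
    then show "l \<in> R" unfolding R_def by (auto intro!: image_eqI[of _ _ p])
  qed
  define z where "z = y - orth_proj R y"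
  have z: "cinner w z = 0" if "w \<in> R" for w
    unfolding z_def by (rule orth_proj(2)[OF R \<open>closed R\<close> that])
  have "z \<in> D \<and> A z = - z"
  proof (rule A_adjoint)
    fix u assume "u \<in> D"
    then have "cinner (A u + u) z = 0" by (intro z) (simp add: R_def)
    then show "cinner (A u) z = cinner u (- z)"
      by (simp add: cinner_add_left cinner_minus_right eq_neg_iff_add_eq_0)
  qed
  then have "z = 0" using norm_le_shift[of z] by simp
  then have "y \<in> R" using orth_proj(1)[OF R \<open>closed R\<close>, of y] by (simp add: z_def)
  then show ?thesis by (auto simp: R_def)
qed

text \<open>The resolvent at -1. Unlike the resolvent at the point supplied by
  \<open>compact_resolvent\<close>, it is sure to be symmetric and nonnegative.\<close>

definition shift_inv :: "'a \<Rightarrow> 'a" where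
  "shift_inv y = (SOME u. u \<in> D \<and> A u + u = y)"

lemma shift_inv: "shift_inv y \<in> D" "A (shift_inv y) + shift_inv y = y"
  using someI_ex[of "\<lambda>u. u \<in> D \<and> A u + u = y"] shift_surj[of y] unfolding shift_inv_def by auto

lemma shift_inv_eqI:
  assumes "u \<in> D" "A u + u = y" shows "shift_inv y = u"
proof -
  have "norm (shift_inv y - u) \<le> norm (A (shift_inv y - u) + (shift_inv y - u))"
    by (rule norm_le_shift) (intro csubspace_diff[OF csubspace_D] shift_inv assms)
  also have "\<dots> = norm ((A (shift_inv y) + shift_inv y) - (A u + u))"
    by (simp add: A_diff shift_inv(1) assms(1) algebra_simps)
  also have "\<dots> = 0" using shift_inv(2) assms(2) by simp
  finally show ?thesis by simp
qed

lemma bounded_linear_shift_inv: "bounded_linear shift_inv"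
proof (rule bounded_linear_intro[where K=1])
  fix x y r
  have "A (shift_inv x + shift_inv y) + (shift_inv x + shift_inv y)
      = (A (shift_inv x) + shift_inv x) + (A (shift_inv y) + shift_inv y)"
    by (simp add: A_add shift_inv(1))
  moreover have "shift_inv x + shift_inv y \<in> D"
    using csubspace_D shift_inv(1) by (simp add: csubspace_def)
  ultimately show "shift_inv (x + y) = shift_inv x + shift_inv y"
    by (intro shift_inv_eqI) (simp_all add: shift_inv(2))
  have "A (r *\<^sub>R shift_inv x) + r *\<^sub>R shift_inv x = r *\<^sub>R (A (shift_inv x) + shift_inv x)"
    by (simp add: A_scaleR shift_inv(1) scaleR_add_right)
  then show "shift_inv (r *\<^sub>R x) = r *\<^sub>R shift_inv x"
    by (intro shift_inv_eqI csubspace_scaleR[OF csubspace_D shift_inv(1)]) (simp add: shift_inv(2))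
  show "norm (shift_inv x) \<le> norm x * 1"
    using norm_le_shift[OF shift_inv(1)[of x]] by (simp add: shift_inv(2))
qed

lemma shift_inv_symmetric: "inner (shift_inv x) y = inner x (shift_inv y)"
proof -
  have "cinner (shift_inv x) (A (shift_inv y) + shift_inv y)
      = cinner (A (shift_inv x) + shift_inv x) (shift_inv y)"
    by (simp add: cinner_add_left cinner_add_right A_symmetric shift_inv(1))
  then show ?thesis by (simp add: shift_inv(2) inner_eq_Re_cinner)
qed

lemma shift_inv_nonneg: "0 \<le> inner x (shift_inv x)"
proof -
  have "inner (A (shift_inv x) + shift_inv x) (shift_inv x) \<ge> 0"
    using A_nonneg[OF shift_inv(1)[of x]] by (simp add: inner_add_left inner_commute[of "A _"])
  then show ?thesis by (simp add: shift_inv(2))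
qed

text \<open>The first resolvent identity transfers compactness from the given point of the resolvent
  set to \<open>-1\<close>.\<close>

lemma shift_inv_compact:
  assumes x: "\<And>n::nat. norm (x n) \<le> 1"
  shows "\<exists>r l. strict_mono (r::nat \<Rightarrow> nat) \<and> (\<lambda>n. shift_inv (x (r n))) \<longlonglongrightarrow> l"
proof -
  obtain z where z: "z \<in> resolvent_set D A" "compact (closure (resolvent D A z ` cball 0 1))"
    using compact_resolvent by (auto simp: compact_resolvent_def)
  define R where "R = resolvent D A z"
  interpret R: bounded_linear R using z(1) by (simp add: resolvent_set_def R_def)
  have bij: "bij_betw (\<lambda>u. A u - z *\<^sub>C u) D UNIV" using z(1) by (simp add: resolvent_set_def)
  have R_eq: "R (A u - z *\<^sub>C u) = u" if "u \<in> D" for u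
    unfolding R_def resolvent_def by (rule inv_into_f_f[OF bij_betw_imp_inj_on[OF bij] that])
  \<comment> \<open>As \<open>shift_inv\<close> is a contraction,
    \<open>x n - (1 + z) *\<^sub>C shift_inv (x n)\<close> has norm at most
    \<open>1 + (1 + cmod z)\<close>; dividing by \<open>c\<close> brings it into the unit ball,
    where compactness of \<open>R\<close> applies.\<close>
  define c where "c = 2 + cmod z"
  define y where "y n = inverse c *\<^sub>R (x n - (1 + z) *\<^sub>C shift_inv (x n))" for n
  have c: "c > 0" by (simp add: c_def add_pos_nonneg)
  have eq: "shift_inv (x n) = c *\<^sub>R R (y n)" for n
  proof -
    have "A (shift_inv (x n)) - z *\<^sub>C shift_inv (x n) = c *\<^sub>R y n"
      using c shift_inv(2)[of "x n"]
      by (simp add: y_def scaleC_add_left algebra_simps)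
    then show ?thesis using R_eq[OF shift_inv(1), of "x n"] by (simp add: R.scaleR)
  qed
  have "norm (y n) \<le> 1" for n
  proof -
    have "norm ((1 + z) *\<^sub>C shift_inv (x n)) = cmod (1 + z) * norm (shift_inv (x n))"
      by (rule norm_scaleC)
    also have "\<dots> \<le> (1 + cmod z) * 1"
      using norm_le_shift[OF shift_inv(1)[of "x n"]] x[of n] norm_triangle_ineq[of 1 z]
      by (intro mult_mono) (auto simp: shift_inv(2))
    finally have "norm (x n - (1 + z) *\<^sub>C shift_inv (x n)) \<le> c"
      using norm_triangle_le_diff[of "x n" "(1 + z) *\<^sub>C shift_inv (x n)" c] x[of n]
      unfolding c_def by simp
    then show ?thesis using c by (simp add: y_def inverse_eq_divide pos_divide_le_eq)
  qed
  then have "\<forall>n. R (y n) \<in> closure (R ` cball 0 1)"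
    by (intro allI subsetD[OF closure_subset] imageI) simp
  then obtain l r where "strict_mono (r::nat \<Rightarrow> nat)" "((\<lambda>n. R (y n)) \<circ> r) \<longlonglongrightarrow> l"
    using seq_compactE[OF compact_imp_seq_compact[OF z(2)[folded R_def]], of "\<lambda>n. R (y n)"] by blast
  then show ?thesis
    unfolding eq by (intro exI[of _ r] exI[of _ "c *\<^sub>R l"]) (auto simp: o_def intro!: tendsto_intros)
qed

section \<open>Eigenspaces: closed, mutually orthogonal, total\<close>

lemma csubspace_E: "csubspace (E l)"
  using csubspace_D unfolding csubspace_def eigenspace_def
  by (auto simp: A_add A_scaleC scaleR_add_right scaleC_scaleR_commute)
     (use A_scaleR[of 0 0] in simp)

lemma closed_E: "closed (E l)"
  unfolding closed_sequential_limits
proof (intro allI impI, elim conjE)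
  fix x u assume x: "\<forall>n. x n \<in> E l" and u: "x \<longlonglongrightarrow> u"
  then have "(\<lambda>n. l *\<^sub>R x n) \<longlonglongrightarrow> l *\<^sub>R u" by (intro tendsto_intros)
  with x have "(\<lambda>n. A (x n)) \<longlonglongrightarrow> l *\<^sub>R u" by (simp add: eigenspace_def)
  with A_closed[of x, OF _ u] x show "u \<in> E l" by (simp add: eigenspace_def)
qed

lemma E_nonneg:
  assumes "e \<in> E l" "e \<noteq> 0" shows "0 \<le> l"
proof -
  have "0 < inner e e" using assms(2) by simp
  moreover have "0 \<le> l * inner e e" using A_nonneg[of e] assms(1) by (simp add: eigenspace_def)
  ultimately show ?thesis unfolding zero_le_mult_iff by linarith
qed

lemma L_nonneg: "l \<in> L \<Longrightarrow> 0 \<le> l"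
  using E_nonneg by (auto simp: eigenvalues_def)

lemma E_orthogonal:
  assumes "l \<noteq> k" "u \<in> E l" "v \<in> E k" shows "cinner u v = 0"
proof -
  have "of_real l * cinner u v = of_real k * cinner u v"
    using A_symmetric[of u v] assms(2,3)
    by (simp add: eigenspace_def cinner_scaleR_left cinner_scaleR_right)
  then show ?thesis using assms(1) by simp
qed

text \<open>An eigenvector of \<open>shift_inv\<close> for \<open>m\<close> is one of
  \<open>A\<close> for \<open>inverse m - 1\<close>; found in the complement \<open>W\<close>, it
  would be orthogonal to itself.\<close>

lemma E_total:
  assumes "\<And>l e. l \<in> L \<Longrightarrow> e \<in> E l \<Longrightarrow> inner e x = 0"
  shows "x = 0"
proof (rule ccontr)
  assume "x \<noteq> 0"
  \<comment> \<open>Letting \<open>l\<close> range over all reals spares a proof that the eigenvalue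
    found below lies in \<open>L\<close>; the additional eigenspaces are zero.\<close>
  define W where "W = {x. \<forall>l. \<forall>e\<in>E l. inner e x = 0}"
  have W: "subspace W" by (auto simp: subspace_def W_def inner_add_right)
  have "W = (\<Inter>l. \<Inter>e\<in>E l. {x. inner e x = 0})" by (auto simp: W_def)
  then have clW: "closed W" by (auto intro!: closed_INT closed_hyperplane)
  have "x \<in> W"
    unfolding W_def
  proof (intro CollectI allI ballI)
    fix l e assume e: "e \<in> E l"
    show "inner e x = 0"
    proof (cases "e = 0")
      case False
      with e have "l \<in> L" by (auto simp: eigenvalues_def)
      with e assms show ?thesis by blast
    qed simp
  qed
  have "shift_inv ` W \<subseteq> W"
  proof safe
    fix w assume w: "w \<in> W"
    have "inner e (shift_inv w) = 0" if e: "e \<in> E l" for e l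
    proof (cases "e = 0")
      case False
      have l: "0 \<le> l" using E_nonneg[OF e False] .
      have eD: "e \<in> D" "A e = l *\<^sub>R e" using e by (auto simp: eigenspace_def)
      \<comment> \<open>On \<open>E l\<close> the inverse acts as a scalar, so by symmetry it
        preserves orthogonality to \<open>E l\<close>.\<close>
      have "shift_inv e = inverse (1 + l) *\<^sub>R e"
      proof (rule shift_inv_eqI)
        show "inverse (1 + l) *\<^sub>R e \<in> D" using csubspace_scaleR[OF csubspace_D eD(1)] .
        have "A (inverse (1 + l) *\<^sub>R e) + inverse (1 + l) *\<^sub>R e
            = (inverse (1 + l) * (1 + l)) *\<^sub>R e"
          by (simp add: A_scaleR eD algebra_simps)
        then show "A (inverse (1 + l) *\<^sub>R e) + inverse (1 + l) *\<^sub>R e = e" using l by simp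
      qed
      then show ?thesis
        using w e by (simp add: W_def shift_inv_symmetric[symmetric])
    qed simp
    then show "shift_inv w \<in> W" by (simp add: W_def)
  qed
  moreover have "shift_inv x \<noteq> 0"
  proof
    assume "shift_inv x = 0"
    then show False using shift_inv(2)[of x] shift_inv(1)[of x] A_scaleR[of 0 0] \<open>x \<noteq> 0\<close> by simp
  qed
  ultimately obtain w m where w: "w \<in> W" "m > 0" "w \<noteq> 0" "shift_inv w = m *\<^sub>R w"
    using compact_positive_eigenvector[OF bounded_linear_shift_inv shift_inv_symmetric
        shift_inv_nonneg W clW _ shift_inv_compact \<open>x \<in> W\<close>] by metis
  have "m *\<^sub>R w \<in> D" using shift_inv(1)[of w] w(4) by simp
  from csubspace_scaleR[OF csubspace_D this, of "inverse m"] have wD: "w \<in> D"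
    using w(2) by simp
  have "m *\<^sub>R (A w + w) = w"
    using shift_inv(2)[of w] by (simp add: w(4) A_scaleR wD scaleR_add_right)
  then have "inverse m *\<^sub>R (m *\<^sub>R (A w + w)) = inverse m *\<^sub>R w" by simp
  then have "A w + w = inverse m *\<^sub>R w" using w(2) by simp
  then have "w \<in> E (inverse m - 1)"
    using wD by (simp add: eigenspace_def scaleR_diff_left eq_diff_eq)
  with w(1) have "inner w w = 0" by (auto simp: W_def)
  with w(3) show False by simp
qed

section \<open>Functional calculus\<close>

lemma Pr_in: "Pr l u \<in> E l"
  by (rule orth_proj(1)[OF csubspace_E closed_E])

lemma Pr_orth: "e \<in> E l \<Longrightarrow> cinner e (u - Pr l u) = 0"
  by (rule orth_proj(2)[OF csubspace_E closed_E])

lemma Pr_eqI: "v \<in> E l \<Longrightarrow> (\<And>e. e \<in> E l \<Longrightarrow> cinner e (u - v) = 0) \<Longrightarrow> Pr l u = v"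
  by (rule orth_proj_eqI[OF csubspace_E])

lemma cinner_Pr_right: "e \<in> E l \<Longrightarrow> cinner e (Pr l u) = cinner e u"
  using Pr_orth[of e l u] by (simp add: cinner_diff_right)

lemma Pr_add: "Pr l (u + v) = Pr l u + Pr l v"
proof (rule Pr_eqI)
  show "Pr l u + Pr l v \<in> E l"
    using csubspace_E[of l] Pr_in by (simp add: csubspace_def)
qed (simp add: cinner_diff_right cinner_add_right cinner_Pr_right)

lemma Pr_scaleC: "Pr l (c *\<^sub>C u) = c *\<^sub>C Pr l u"
  by (rule Pr_eqI)
     (simp_all add: csubspace_scaleC[OF csubspace_E] Pr_in cinner_diff_right cinner_scaleC_right
       cinner_Pr_right)

lemma Pr_scaleR: "Pr l (r *\<^sub>R u) = r *\<^sub>R Pr l u"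
  using Pr_scaleC[of l "of_real r" u] by (simp add: scaleC_of_real)

lemma Pr_diff: "Pr l (u - v) = Pr l u - Pr l v"
  using Pr_add[of l "u - v" v] by simp

lemma Pr_E: "e \<in> E l \<Longrightarrow> Pr l e = e"
  by (rule Pr_eqI) simp_all

lemma Pr_E_other:
  assumes "e \<in> E k" "k \<noteq> l" shows "Pr l e = 0"
proof (rule Pr_eqI)
  show "0 \<in> E l" using csubspace_E[of l] by (simp add: csubspace_def)
qed (use assms E_orthogonal[of l k _ e] in auto)

lemma cinner_Pr: "cinner (Pr l u) (Pr l v) = cinner (Pr l u) v"
  by (rule cinner_Pr_right[OF Pr_in])

lemma Pr_orthogonal: "l \<noteq> k \<Longrightarrow> inner (Pr l u) (Pr k v) = 0"
  using E_orthogonal[OF _ Pr_in Pr_in] by (simp add: inner_eq_Re_cinner)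

lemma inner_Pr_self: "inner (Pr l u) u = (norm (Pr l u))\<^sup>2"
proof -
  have "cinner (Pr l u) u = of_real ((norm (Pr l u))\<^sup>2)"
    by (simp only: cinner_Pr[of l u u, symmetric] norm_cinner_self)
  then show ?thesis by (simp only: inner_eq_Re_cinner Re_complex_of_real)
qed

lemma bounded_linear_Pr: "bounded_linear (Pr l)"
proof (rule bounded_linear_intro[where K=1])
  show "norm (Pr l u) \<le> norm u * 1" for u
  proof (cases "Pr l u = 0")
    case False
    have "norm (Pr l u) * norm (Pr l u) \<le> norm (Pr l u) * norm u"
      using norm_cauchy_schwarz[of "Pr l u" u] by (simp add: inner_Pr_self power2_eq_square)
    with False show ?thesis by simp
  qed simp
qed (simp_all add: Pr_add Pr_scaleR)

text \<open>\<open>Pr k\<close> is continuous and annihilates every other eigenspace, so it can be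
  applied term by term and only one term survives.\<close>

lemma Pr_has_sum:
  assumes v: "\<And>l. l \<in> L \<Longrightarrow> v l \<in> E l" and sum: "(v has_sum x) L" and k: "k \<in> L"
  shows "Pr k x = v k"
proof -
  have "((\<lambda>l. Pr k (v l)) has_sum Pr k x) L"
    by (rule has_sum_bounded_linear[OF bounded_linear_Pr sum])
  moreover have "((\<lambda>l. Pr k (v l)) has_sum v k) L"
  proof (rule has_sum_finite_neutralI[of "{k}"])
    show "v k = (\<Sum>l\<in>{k}. Pr k (v l))" using v[OF k] by (simp add: Pr_E)
  qed (use k v Pr_E_other in auto)
  ultimately show ?thesis by (rule has_sum_unique)
qed

text \<open>Totality of the eigenspaces in the form in which it is used from here on.\<close>

lemma Pr_ext:
  assumes "\<And>l. l \<in> L \<Longrightarrow> Pr l u = Pr l v"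
  shows "u = v"
proof -
  have "u - v = 0"
  proof (rule E_total)
    fix l e assume "l \<in> L" "e \<in> E l"
    then have "cinner e (u - v) = 0"
      using cinner_Pr_right[of e l "u - v"] assms[of l] by (simp add: Pr_diff)
    then show "inner e (u - v) = 0" by (simp add: inner_eq_Re_cinner)
  qed
  then show ?thesis by simp
qed

text \<open>Bessel's inequality: a finite partial sum \<open>S\<close> satisfies
  \<open>norm S * norm S = inner S u\<close>, whence \<open>norm S \<le> norm u\<close>.\<close>

lemma bessel_summable: "(\<lambda>l. (norm (Pr l u))\<^sup>2) summable_on L"
proof (rule nonneg_bounded_partial_sums_imp_summable_on)
  show "\<forall>\<^sub>F F in finite_subsets_at_top L. (\<Sum>l\<in>F. (norm (Pr l u))\<^sup>2) \<le> (norm u)\<^sup>2"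
  proof (rule eventually_finite_subsets_at_top_weakI)
    fix F assume F: "finite F" "F \<subseteq> L"
    define S where "S = (\<Sum>l\<in>F. Pr l u)"
    have S: "(norm S)\<^sup>2 = (\<Sum>l\<in>F. (norm (Pr l u))\<^sup>2)"
      unfolding S_def by (rule norm_sum_orthogonal) (simp_all add: F Pr_orthogonal)
    then have "norm S * norm S = inner S u"
      by (simp add: S_def inner_sum_left inner_Pr_self power2_eq_square[symmetric])
    also have "\<dots> \<le> norm S * norm u" by (rule norm_cauchy_schwarz)
    finally have "norm S \<le> norm u" by (cases "S = 0") auto
    then show "(\<Sum>l\<in>F. (norm (Pr l u))\<^sup>2) \<le> (norm u)\<^sup>2"
      unfolding S[symmetric] by (intro power_mono) auto
  qed
qed simp

text \<open>Bessel's inequality makes the series converge to some vector; this vector has the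
  coefficients of \<open>u\<close>, so \<open>Pr_ext\<close> identifies it.\<close>

lemma eigen_expansion: "((\<lambda>l. Pr l u) has_sum u) L"
proof -
  have "(\<lambda>l. Pr l u) summable_on L"
    by (rule summable_on_orthogonal[OF Pr_orthogonal bessel_summable])
  then have s: "((\<lambda>l. Pr l u) has_sum (\<Sum>\<^sub>\<infinity>l\<in>L. Pr l u)) L" by (rule has_sum_infsum)
  have "(\<Sum>\<^sub>\<infinity>l\<in>L. Pr l u) = u"
    by (rule Pr_ext) (rule Pr_has_sum[OF Pr_in s])
  with s show ?thesis by simp
qed

lemma parseval: "((\<lambda>l. (norm (Pr l u))\<^sup>2) has_sum (norm u)\<^sup>2) L"
  by (rule has_sum_norm_square_orthogonal[OF Pr_orthogonal eigen_expansion])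

text \<open>Membership in \<open>fcalc_dom\<close> is square summability, which orthogonality
  upgrades to convergence; so the infinite sum in \<open>fcalc\<close> is a genuine limit and not
  the default 0.\<close>

lemma Pr_fcalc:
  assumes "u \<in> fcalc_dom D A f" and l: "l \<in> L"
  shows "Pr l (fcalc D A f u) = f l *\<^sub>R Pr l u"
proof -
  have "(\<lambda>l. f l *\<^sub>R Pr l u) summable_on L"
    by (rule summable_on_orthogonal)
       (use assms(1) in \<open>simp_all add: Pr_orthogonal fcalc_dom_def\<close>)
  then have "((\<lambda>l. f l *\<^sub>R Pr l u) has_sum fcalc D A f u) L"
    unfolding fcalc_def by (rule has_sum_infsum)
  then show ?thesis
    by (rule Pr_has_sum[OF csubspace_scaleR[OF csubspace_E Pr_in] _ l])
qed

section \<open>The scale of spaces and its norms\<close>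

abbreviation X :: "real \<Rightarrow> 'a set" where "X \<equiv> Hsp D A"
abbreviation nX :: "real \<Rightarrow> 'a \<Rightarrow> real" where "nX \<equiv> Hnorm D A"

text \<open>Parseval's identity turns the scale norm into a weighted square sum of
  coefficients.\<close>

lemma Hnorm_has_sum:
  assumes "u \<in> X r"
  shows "((\<lambda>l. ((1 + l) powr r * norm (Pr l u))\<^sup>2) has_sum (nX r u)\<^sup>2) L"
proof -
  have "((\<lambda>l. (norm (Pr l (fcalc D A (\<lambda>l. (1 + l) powr r) u)))\<^sup>2) has_sum (nX r u)\<^sup>2) L"
    unfolding Hnorm_def by (rule parseval)
  moreover have "(norm (Pr l (fcalc D A (\<lambda>l. (1 + l) powr r) u)))\<^sup>2 = ((1 + l) powr r * norm (Pr l u))\<^sup>2"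
    if "l \<in> L" for l
    using Pr_fcalc[OF assms[unfolded Hsp_def] that] by simp
  ultimately show ?thesis by (simp only: cong: has_sum_cong)
qed

lemma Hnorm_nonneg: "0 \<le> nX r u"
  by (simp add: Hnorm_def)

text \<open>The common source of the estimates on scaling, on \<open>P\<close> and on its
  complement: a bound on every coefficient yields membership and norm bound together, by comparing
  the square sums.\<close>

lemma Hsp_comparison:
  assumes u: "u \<in> X s" and c: "0 \<le> c"
    and le: "\<And>l. l \<in> L \<Longrightarrow> (1 + l) powr r * norm (Pr l v) \<le> c * ((1 + l) powr s * norm (Pr l u))"
  shows "v \<in> X r" and "nX r v \<le> c * nX s u"
proof -
  have le2: "((1 + l) powr r * norm (Pr l v))\<^sup>2 \<le> c\<^sup>2 * ((1 + l) powr s * norm (Pr l u))\<^sup>2"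
    if "l \<in> L" for l
    using power_mono[OF le[OF that], of 2] by (simp add: power_mult_distrib)
  have s: "((\<lambda>l. c\<^sup>2 * ((1 + l) powr s * norm (Pr l u))\<^sup>2) has_sum c\<^sup>2 * (nX s u)\<^sup>2) L"
    by (intro has_sum_cmult_right Hnorm_has_sum u)
  have "(\<lambda>l. ((1 + l) powr r * norm (Pr l v))\<^sup>2) summable_on L"
    by (rule summable_on_comparison_test[OF has_sum_imp_summable[OF s]]) (simp_all add: le2)
  then show v: "v \<in> X r" by (simp add: Hsp_def fcalc_dom_def)
  have "(nX r v)\<^sup>2 \<le> c\<^sup>2 * (nX s u)\<^sup>2"
    by (rule has_sum_mono[OF Hnorm_has_sum[OF v] s le2])
  then have "(nX r v)\<^sup>2 \<le> (c * nX s u)\<^sup>2" by (simp add: power_mult_distrib)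
  then show "nX r v \<le> c * nX s u"
    by (rule power2_le_imp_le) (simp add: c Hnorm_nonneg)
qed

text \<open>Exponent zero recovers the Hilbert space, so that bounds in its own norm become
  instances of \<open>Hsp_comparison\<close>.\<close>

lemma
  shows Hsp_0: "u \<in> X 0" and Hnorm_0: "nX 0 u = norm u"
proof -
  \<comment> \<open>\<open>0 powr 0\<close> is 0, so the base must be known to be nonzero; the
    eigenvalues are nonnegative.\<close>
  have one: "(1 + l) powr 0 = 1" if "l \<in> L" for l
    using L_nonneg[OF that] by simp
  have "(\<lambda>l. ((1 + l) powr 0 * norm (Pr l u))\<^sup>2) summable_on L"
    using bessel_summable[of u] summable_on_cong[of L "\<lambda>l. ((1 + l) powr 0 * norm (Pr l u))\<^sup>2"
      "\<lambda>l. (norm (Pr l u))\<^sup>2"] one by simp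
  then show u: "u \<in> X 0" by (simp add: Hsp_def fcalc_dom_def)
  have "fcalc D A (\<lambda>l. (1 + l) powr 0) u = u"
  proof (rule Pr_ext)
    fix l assume "l \<in> L"
    then show "Pr l (fcalc D A (\<lambda>l. (1 + l) powr 0) u) = Pr l u"
      unfolding Pr_fcalc[OF u[unfolded Hsp_def] \<open>l \<in> L\<close>] one[OF \<open>l \<in> L\<close>] by simp
  qed
  then show "nX 0 u = norm u" by (simp add: Hnorm_def)
qed

lemma
  assumes "u \<in> X r"
  shows Hsp_scaleR: "c *\<^sub>R u \<in> X r" and Hnorm_scaleR_le: "nX r (c *\<^sub>R u) \<le> \<bar>c\<bar> * nX r u"
proof -
  have le: "(1 + l) powr r * norm (Pr l (c *\<^sub>R u)) \<le> \<bar>c\<bar> * ((1 + l) powr r * norm (Pr l u))" for l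
    by (simp add: Pr_scaleR)
  show "c *\<^sub>R u \<in> X r" by (rule Hsp_comparison(1)[OF assms _ le]) simp
  show "nX r (c *\<^sub>R u) \<le> \<bar>c\<bar> * nX r u" by (rule Hsp_comparison(2)[OF assms _ le]) simp
qed

lemma norm_le_Hnorm:
  assumes "0 \<le> r" "u \<in> X r" shows "norm u \<le> nX r u"
proof -
  have "nX 0 u \<le> 1 * nX r u"
  proof (rule Hsp_comparison(2)[OF assms(2)])
    fix l assume "l \<in> L"
    then have "1 \<le> (1 + l) powr r" using L_nonneg assms(1) by (simp add: ge_one_powr_ge_zero)
    then show "(1 + l) powr 0 * norm (Pr l u) \<le> 1 * ((1 + l) powr r * norm (Pr l u))"
      using mult_right_mono[of 1 "(1 + l) powr r" "norm (Pr l u)"] L_nonneg[OF \<open>l \<in> L\<close>] by simp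
  qed simp
  then show ?thesis by (simp add: Hnorm_0)
qed

section \<open>Spectral projections\<close>

abbreviation P :: "real \<Rightarrow> 'a \<Rightarrow> 'a" where "P \<equiv> spec_proj D A"

text \<open>The indicator is bounded, so every vector is in its domain and \<open>P N\<close> acts
  on coefficients as a cutoff; the algebra of \<open>P\<close> then follows by
  \<open>Pr_ext\<close>.\<close>

lemma Pr_P:
  assumes "l \<in> L" shows "Pr l (P N u) = (if l \<le> N then Pr l u else 0)"
proof -
  have "(\<lambda>l. (norm (indicator {0..N} l *\<^sub>R Pr l u))\<^sup>2) summable_on L"
    by (rule summable_on_comparison_test[OF bessel_summable[of u]]) (auto simp: indicator_def)
  then have "u \<in> fcalc_dom D A (indicator {0..N})" by (simp add: fcalc_dom_def)
  from Pr_fcalc[OF this assms] show ?thesis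
    using L_nonneg[OF assms] by (simp add: spec_proj_def indicator_def)
qed

lemma P_add: "P N (u + v) = P N u + P N v"
  by (rule Pr_ext) (simp add: Pr_P Pr_add)

lemma P_scaleC: "P N (c *\<^sub>C u) = c *\<^sub>C P N u"
  by (rule Pr_ext) (simp add: Pr_P Pr_scaleC)

lemma P_scaleR: "P N (r *\<^sub>R u) = r *\<^sub>R P N u"
  by (rule Pr_ext) (simp add: Pr_P Pr_scaleR)

lemma P_diff: "P N (u - v) = P N u - P N v"
  by (rule Pr_ext) (simp add: Pr_P Pr_diff)

lemma P_P [simp]: "P N (P N u) = P N u"
  by (rule Pr_ext) (simp add: Pr_P)

text \<open>Expand the second argument over the eigenspaces: pairing with \<open>P N x\<close> kills
  the terms with \<open>l > N\<close>, so projecting the second argument changes nothing. Both sides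
  then equal the pairing of the two projections.\<close>

lemma P_symmetric: "cinner (P N u) v = cinner u (P N v)"
proof -
  have *: "cinner (P N x) y = cinner (P N x) (P N y)" for x y
  proof -
    have c: "((\<lambda>l. cinner (P N x) (Pr l z)) has_sum cinner (P N x) z) L" for z
      by (rule has_sum_homomorphism[OF eigen_expansion])
         (simp_all add: cinner_add_right continuous_on_cinner_right)
    have eq: "cinner (P N x) (Pr l (P N y)) = cinner (P N x) (Pr l y)" if "l \<in> L" for l
    proof (cases "l \<le> N")
      case False
      have "cinner (Pr l y) (P N x) = cinner (Pr l y) (Pr l (P N x))" by (rule cinner_Pr[symmetric])
      also have "\<dots> = 0" using that False by (simp add: Pr_P)
      finally have "cinner (P N x) (Pr l y) = 0" by (metis cinner_commute complex_cnj_zero)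
      with that False show ?thesis by (simp add: Pr_P)
    qed (simp add: that Pr_P)
    have "((\<lambda>l. cinner (P N x) (Pr l y)) has_sum cinner (P N x) (P N y)) L"
      using c[of "P N y"] by (simp only: eq cong: has_sum_cong)
    with c[of y] show ?thesis by (rule has_sum_unique)
  qed
  show ?thesis using *[of u v] *[of v u] by (metis cinner_commute)
qed

lemma norm_P_le: "norm (P N u) \<le> norm u"
proof -
  have "nX 0 (P N u) \<le> 1 * nX 0 u"
    by (rule Hsp_comparison(2)[OF Hsp_0]) (use L_nonneg in \<open>auto simp: Pr_P\<close>)
  then show ?thesis by (simp add: Hnorm_0)
qed

lemma bounded_linear_P: "bounded_linear (P N)"
  by (rule bounded_linear_intro[where K=1]) (simp_all add: P_add P_scaleR norm_P_le)

lemma csubspace_range_P: "csubspace (range (P N))"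
  unfolding csubspace_def
  by (auto simp flip: P_add P_scaleC) (metis P_scaleR scaleR_zero_left rangeI)

text \<open>On the retained eigenvalues the weight is at most its value at \<open>N\<close>. The
  growth in \<open>N\<close> is harmless: the norm bound serves to make the compressed generator
  bounded.\<close>

lemma P_Hsp:
  assumes "0 \<le> r" "0 \<le> N"
  shows "P N u \<in> X r" and "nX r (P N u) \<le> (1 + N) powr r * norm u"
proof -
  have le: "(1 + l) powr r * norm (Pr l (P N u)) \<le> (1 + N) powr r * ((1 + l) powr 0 * norm (Pr l u))"
    if "l \<in> L" for l
    using L_nonneg[OF that] assms by (auto simp: Pr_P[OF that] intro!: mult_right_mono powr_mono2)
  show "P N u \<in> X r" by (rule Hsp_comparison(1)[OF Hsp_0 _ le]) simp_all
  have "nX r (P N u) \<le> (1 + N) powr r * nX 0 u" by (rule Hsp_comparison(2)[OF Hsp_0 _ le]) simp_all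
  then show "nX r (P N u) \<le> (1 + N) powr r * norm u" by (simp add: Hnorm_0)
qed

text \<open>The discarded eigenvalues exceed \<open>N\<close>, and the exponent \<open>r - s\<close>
  is nonpositive. Used with \<open>s = \<mu> + \<sigma>\<close> and \<open>r = \<mu>\<close> or
  \<open>r = 0\<close>, this yields the two powers of \<open>1 + N\<close> in the error
  bound.\<close>

lemma Q_Hsp:
  assumes "r \<le> s" "0 \<le> N" "u \<in> X s"
  shows "u - P N u \<in> X r" and "nX r (u - P N u) \<le> (1 + N) powr (r - s) * nX s u"
proof -
  have le: "(1 + l) powr r * norm (Pr l (u - P N u))
      \<le> (1 + N) powr (r - s) * ((1 + l) powr s * norm (Pr l u))" if "l \<in> L" for l
  proof (cases "l \<le> N")
    case False
    have "(1 + l) powr r = (1 + l) powr (r - s) * (1 + l) powr s"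
      by (simp add: powr_add[symmetric])
    also have "\<dots> \<le> (1 + N) powr (r - s) * (1 + l) powr s"
      using False assms by (intro mult_right_mono powr_mono2') auto
    finally show ?thesis
      using False that by (simp add: Pr_diff Pr_P mult_right_mono mult.assoc[symmetric])
  qed (simp add: that Pr_diff Pr_P)
  show "u - P N u \<in> X r" by (rule Hsp_comparison(1)[OF assms(3) _ le]) simp_all
  show "nX r (u - P N u) \<le> (1 + N) powr (r - s) * nX s u"
    by (rule Hsp_comparison(2)[OF assms(3) _ le]) simp_all
qed

end

section \<open>Linear evolution equations with bounded generators\<close>

text \<open>Only the component of \<open>e'\<close> along \<open>e\<close> is controlled, so a skew
  part of the generator costs nothing. With \<open>K = 0\<close> this gives norm conservation,
  uniqueness and an invariant subspace; with \<open>K\<close> a bound on the residual, the Galerkin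
  error.\<close>

lemma energy_bound:
  fixes e :: "real \<Rightarrow> 'a::real_inner"
  assumes S: "convex S" and K: "0 \<le> K"
    and e': "\<And>t. t \<in> S \<Longrightarrow> (e has_vector_derivative e' t) (at t within S)"
    and bnd: "\<And>t. t \<in> S \<Longrightarrow> \<bar>inner (e t) (e' t)\<bar> \<le> K * norm (e t)"
    and st: "s \<in> S" "t \<in> S"
  shows "norm (e t) \<le> norm (e s) + K * \<bar>t - s\<bar>"
proof (rule field_le_epsilon)
  \<comment> \<open>The norm need not be differentiable where \<open>e\<close> vanishes, hence the regularisation.\<close>
  fix \<epsilon> :: real assume \<epsilon>: "0 < \<epsilon>"
  define h where "h t = sqrt (\<epsilon>\<^sup>2 + inner (e t) (e t))" for t
  have pos: "0 < \<epsilon>\<^sup>2 + inner (e t) (e t)" for t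
    using \<epsilon> by (simp add: add_pos_nonneg)
  have hpos: "0 < h t" for t using pos by (simp add: h_def)
  have he: "norm (e t) \<le> h t" for t
    unfolding h_def norm_eq_sqrt_inner by (intro real_sqrt_le_mono) simp
  have hle: "h t \<le> \<epsilon> + norm (e t)" for t
  proof -
    have "h t \<le> sqrt (\<epsilon>\<^sup>2) + sqrt (inner (e t) (e t))"
      unfolding h_def by (rule sqrt_add_le_add_sqrt) auto
    then show ?thesis using \<epsilon> by (simp add: norm_eq_sqrt_inner)
  qed
  have "(h has_field_derivative inner (e x) (e' x) / h x) (at x within S)" if "x \<in> S" for x
  proof -
    have "((\<lambda>t. inner (e t) (e t)) has_derivative (\<lambda>d. inner (e x) (d *\<^sub>R e' x) + inner (d *\<^sub>R e' x) (e x))) (at x within S)"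
      by (intro has_derivative_inner e'[OF that, unfolded has_vector_derivative_def])
    from has_derivative_add[OF has_derivative_const this, of "\<epsilon>\<^sup>2"]
    have 1: "((\<lambda>t. \<epsilon>\<^sup>2 + inner (e t) (e t)) has_field_derivative 2 * inner (e x) (e' x)) (at x within S)"
      unfolding has_field_derivative_def
      by (rule has_derivative_eq_rhs) (simp add: fun_eq_iff inner_commute)
    have "(h has_field_derivative inverse (sqrt (\<epsilon>\<^sup>2 + inner (e x) (e x))) / 2 * (2 * inner (e x) (e' x))) (at x within S)"
      unfolding h_def by (rule DERIV_chain2[OF DERIV_real_sqrt[OF pos] 1])
    moreover have "inverse (sqrt (\<epsilon>\<^sup>2 + inner (e x) (e x))) / 2 * (2 * inner (e x) (e' x)) = inner (e x) (e' x) / h x"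
      unfolding h_def[of x] divide_inverse by simp
    ultimately show ?thesis by (rule DERIV_cong)
  qed
  moreover have "norm (inner (e x) (e' x) / h x) \<le> K" if "x \<in> S" for x
  proof -
    have "\<bar>inner (e x) (e' x)\<bar> \<le> K * h x"
      using bnd[OF that] mult_left_mono[OF he K] by (rule order_trans)
    then show ?thesis using hpos[of x] by (simp add: pos_divide_le_eq)
  qed
  ultimately have "norm (h t - h s) \<le> K * norm (t - s)"
    by (rule field_differentiable_bound[OF S]) (use st in auto)
  then show "norm (e t) \<le> norm (e s) + K * \<bar>t - s\<bar> + \<epsilon>"
    using he[of t] hle[of s] by simp
qed

text \<open>Mean value inequality with an antiderivative of the bound as majorant, on each side of
  \<open>s\<close> separately. Iteration produces the factorials of the Picard series;
  \<open>n = 0\<close> is a Lipschitz estimate.\<close>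

lemma norm_diff_le_power:
  fixes f :: "real \<Rightarrow> 'a::real_normed_vector"
  assumes f': "\<And>t. t \<in> {a..b} \<Longrightarrow> (f has_vector_derivative f' t) (at t within {a..b})"
    and bnd: "\<And>t. t \<in> {a..b} \<Longrightarrow> norm (f' t) \<le> c * \<bar>t - s\<bar> ^ n"
    and st: "s \<in> {a..b}" "t \<in> {a..b}"
  shows "norm (f t - f s) \<le> c * \<bar>t - s\<bar> ^ Suc n / real (Suc n)"
proof -
  have cont: "continuous_on {a..b} f"
    by (rule continuous_on_vector_derivative[OF f'])
  have at: "(f has_vector_derivative f' x) (at x)" if "a < x" "x < b" for x
  proof -
    have "at x within {a..b} = at x" by (rule at_within_interior) (use that in simp)
    with f'[of x] that show ?thesis by simp
  qed
  consider "s < t" | "t < s" | "s = t" by linarith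
  then show ?thesis
  proof cases
    case 1
    have "norm (f t - f s) \<le> c * (t - s) ^ Suc n / real (Suc n) - c * (s - s) ^ Suc n / real (Suc n)"
    proof (rule differentiable_bound_general[OF 1])
      show "continuous_on {s..t} f" by (rule continuous_on_subset[OF cont]) (use st in auto)
      show "continuous_on {s..t} (\<lambda>x. c * (x - s) ^ Suc n / real (Suc n))"
        by (intro continuous_intros) auto
      show "(f has_vector_derivative f' x) (at x)" if "s < x" "x < t" for x
        by (rule at) (use that st in auto)
      show "((\<lambda>x. c * (x - s) ^ Suc n / real (Suc n)) has_vector_derivative c * (x - s) ^ n) (at x)" for x
        unfolding has_real_derivative_iff_has_vector_derivative[symmetric]
        by (auto intro!: derivative_eq_intros simp del: power_Suc of_nat_Suc)
      show "norm (f' x) \<le> c * (x - s) ^ n" if "s < x" "x < t" for x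
        using bnd[of x] that st by simp
    qed
    then show ?thesis using 1 by simp
  next
    case 2
    have "norm (f s - f t) \<le> - c * (s - s) ^ Suc n / real (Suc n) - - c * (s - t) ^ Suc n / real (Suc n)"
    proof (rule differentiable_bound_general[OF 2])
      show "continuous_on {t..s} f" by (rule continuous_on_subset[OF cont]) (use st in auto)
      show "continuous_on {t..s} (\<lambda>x. - c * (s - x) ^ Suc n / real (Suc n))"
        by (intro continuous_intros) auto
      show "(f has_vector_derivative f' x) (at x)" if "t < x" "x < s" for x
        by (rule at) (use that st in auto)
      show "((\<lambda>x. - c * (s - x) ^ Suc n / real (Suc n)) has_vector_derivative c * (s - x) ^ n) (at x)" for x
        unfolding has_real_derivative_iff_has_vector_derivative[symmetric]
        by (auto intro!: derivative_eq_intros simp del: power_Suc of_nat_Suc)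
      show "norm (f' x) \<le> c * (s - x) ^ n" if "t < x" "x < s" for x
        using bnd[of x] that st by simp
    qed
    then show ?thesis using 2 by (simp add: norm_minus_commute)
  qed simp
qed

text \<open>The terms of the Picard (Dyson) series, not its partial sums. The integral from
  \<open>s\<close> to \<open>t\<close> is written as a difference of integrals from
  \<open>a\<close>, since an integral over \<open>{s..t}\<close> would be 0 for
  \<open>t < s\<close>.\<close>

primrec picard :: "(real \<Rightarrow> 'a \<Rightarrow>\<^sub>L 'a) \<Rightarrow> real \<Rightarrow> real \<Rightarrow> 'a \<Rightarrow> nat \<Rightarrow> real \<Rightarrow> 'a::banach" where
  "picard A a s u 0 = (\<lambda>t. u)"
| "picard A a s u (Suc n) = (\<lambda>t. integral {a..t} (\<lambda>\<tau>. A \<tau> (picard A a s u n \<tau>))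
      - integral {a..s} (\<lambda>\<tau>. A \<tau> (picard A a s u n \<tau>)))"

text \<open>The solution is the sum of the Picard series. Its terms are dominated by those of the
  exponential series of \<open>M * (b - a)\<close>, so the differentiated series converges uniformly
  and may be summed termwise.\<close>

lemma linear_ode_exists:
  fixes A :: "real \<Rightarrow> 'a::banach \<Rightarrow>\<^sub>L 'a"
  assumes A: "continuous_on {a..b} A" and s: "s \<in> {a..b}"
  shows "\<exists>x. x s = u \<and> (\<forall>t\<in>{a..b}. (x has_vector_derivative A t (x t)) (at t within {a..b}))"
proof -
  let ?p = "picard A a s u"
  obtain M where M: "0 < M" "\<And>t. t \<in> {a..b} \<Longrightarrow> norm (A t) \<le> M"
    using compact_imp_bounded[OF compact_continuous_image[OF A compact_Icc]]
    unfolding bounded_pos by auto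
  have deriv: "(?p (Suc n) has_vector_derivative A t (?p n t)) (at t within {a..b})"
    if "continuous_on {a..b} (?p n)" "t \<in> {a..b}" for n t
  proof -
    have "continuous_on {a..b} (\<lambda>\<tau>. A \<tau> (?p n \<tau>))"
      by (intro blinfun.continuous_on A that)
    from integral_has_vector_derivative[OF this that(2)] show ?thesis
      unfolding picard.simps by (simp add: has_vector_derivative_diff_const)
  qed
  have cont: "continuous_on {a..b} (?p n)" for n
  proof (induction n)
    case (Suc n)
    show ?case by (rule continuous_on_vector_derivative[OF deriv[OF Suc]])
  qed simp
  note deriv = deriv[OF cont]
  \<comment> \<open>At \<open>s\<close> every integral term vanishes, which gives the initial
    value.\<close>
  have "?p n s = (if n = 0 then u else 0)" for n by (cases n) simp_all
  then have p_sums: "(\<lambda>n. ?p n s) sums u"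
    using sums_single[of 0 "\<lambda>_. u"] by presburger
  have A_le: "norm (A t x) \<le> M * norm x" if "t \<in> {a..b}" for t x
    using norm_blinfun[of "A t" x] mult_right_mono[OF M(2)[OF that], of "norm x"] by simp
  have bound: "norm (?p n t) \<le> norm u * M ^ n / fact n * \<bar>t - s\<bar> ^ n" if "t \<in> {a..b}" for n t
    using that
  proof (induction n arbitrary: t)
    case (Suc n)
    have "norm (?p (Suc n) t - ?p (Suc n) s)
        \<le> (norm u * M ^ Suc n / fact n) * \<bar>t - s\<bar> ^ Suc n / real (Suc n)"
    proof (rule norm_diff_le_power[OF deriv _ s Suc.prems])
      fix \<tau> assume \<tau>: "\<tau> \<in> {a..b}"
      have "norm (A \<tau> (?p n \<tau>)) \<le> M * norm (?p n \<tau>)" by (rule A_le[OF \<tau>])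
      also have "\<dots> \<le> M * (norm u * M ^ n / fact n * \<bar>\<tau> - s\<bar> ^ n)"
        using Suc.IH[OF \<tau>] M(1) by (intro mult_left_mono) auto
      finally show "norm (A \<tau> (?p n \<tau>)) \<le> norm u * M ^ Suc n / fact n * \<bar>\<tau> - s\<bar> ^ n"
        by (simp add: mult_ac)
    qed
    also have "\<dots> = norm u * M ^ Suc n / fact (Suc n) * \<bar>t - s\<bar> ^ Suc n"
      by (simp add: fact_Suc del: of_nat_Suc power_Suc)
    finally show ?case by simp
  qed simp
  define q where "q n = norm u * (inverse (fact n) * (M * (b - a)) ^ n)" for n
  have q: "norm (?p n t) \<le> q n" if "t \<in> {a..b}" for n t
  proof -
    have "norm (?p n t) \<le> norm u * M ^ n / fact n * \<bar>t - s\<bar> ^ n" by (rule bound[OF that])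
    also have "\<dots> \<le> norm u * M ^ n / fact n * (b - a) ^ n"
      using that s M(1) by (intro mult_left_mono power_mono) auto
    finally show ?thesis by (simp add: q_def power_mult_distrib divide_inverse mult_ac)
  qed
  have sq: "summable q"
    unfolding q_def by (intro summable_mult summable_exp)
  \<comment> \<open>The derivative of each term is \<open>A t\<close> applied to the preceding one,
    and 0 for the constant term; because of this shift the differentiated series sums to
    \<open>A t (g t)\<close>.\<close>
  define f' where "f' n t = (case n of 0 \<Rightarrow> 0 | Suc m \<Rightarrow> A t (?p m t))" for n t
  define c where "c n = (case n of 0 \<Rightarrow> 0 | Suc m \<Rightarrow> M * q m)" for n
  have "summable c"
    using summable_mult[OF sq, of M] summable_Suc_iff[of c] by (simp add: c_def)
  have "norm (f' n t) \<le> c n" if "t \<in> {a..b}" for n t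
    using order_trans[OF A_le[OF that] mult_left_mono[OF q[OF that]]] M(1)
    by (simp add: f'_def c_def split: nat.split)
  from Weierstrass_m_test[OF this \<open>summable c\<close>]
  have ul: "uniform_limit {a..b} (\<lambda>n t. \<Sum>i<n. f' i t) (\<lambda>t. \<Sum>i. f' i t) sequentially" .
  have "\<exists>g. \<forall>t\<in>{a..b}. (\<lambda>n. ?p n t) sums g t \<and>
      (g has_derivative (\<lambda>h. h *\<^sub>R (\<Sum>i. f' i t))) (at t within {a..b})"
  proof (rule has_derivative_series[OF convex_real_interval(5)])
    show "(?p n has_derivative (\<lambda>h. h *\<^sub>R f' n t)) (at t within {a..b})" if "t \<in> {a..b}" for n t
    proof (cases n)
      case (Suc m)
      with deriv[OF that, of m] show ?thesis
        by (simp add: f'_def has_vector_derivative_def)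
    qed (simp add: f'_def)
    show "\<forall>\<^sub>F n in sequentially. \<forall>t\<in>{a..b}. \<forall>h.
        norm ((\<Sum>i<n. h *\<^sub>R f' i t) - h *\<^sub>R (\<Sum>i. f' i t)) \<le> e * norm h" if "e > 0" for e
      using uniform_limitD[OF ul that]
    proof eventually_elim
      case (elim n)
      show ?case
      proof (intro ballI allI)
        fix t h :: real assume "t \<in> {a..b}"
        with elim have "norm ((\<Sum>i<n. f' i t) - (\<Sum>i. f' i t)) \<le> e"
          by (force simp: dist_norm)
        from mult_left_mono[OF this, of "norm h"]
        have "norm (h *\<^sub>R ((\<Sum>i<n. f' i t) - (\<Sum>i. f' i t))) \<le> e * norm h"
          by (simp add: mult.commute)
        then show "norm ((\<Sum>i<n. h *\<^sub>R f' i t) - h *\<^sub>R (\<Sum>i. f' i t)) \<le> e * norm h"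
          by (simp only: scaleR_sum_right scaleR_diff_right)
      qed
    qed
    show "s \<in> {a..b}" by (rule s)
    show "(\<lambda>n. ?p n s) sums u" by (rule p_sums)
  qed
  then obtain g where g: "\<And>t. t \<in> {a..b} \<Longrightarrow> (\<lambda>n. ?p n t) sums g t"
    "\<And>t. t \<in> {a..b} \<Longrightarrow> (g has_vector_derivative (\<Sum>i. f' i t)) (at t within {a..b})"
    unfolding has_vector_derivative_def by blast
  have "(\<Sum>i. f' i t) = A t (g t)" if "t \<in> {a..b}" for t
  proof -
    have "(\<lambda>n. f' (Suc n) t) sums A t (g t)"
      using bounded_linear.sums[OF blinfun.bounded_linear_right g(1)[OF that]] by (simp add: f'_def)
    then have "(\<lambda>n. f' n t) sums (A t (g t) + f' 0 t)" by (rule sums_Suc)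
    then show ?thesis by (simp add: f'_def sums_iff)
  qed
  moreover have "g s = u" by (rule sums_unique2[OF g(1)[OF s] p_sums])
  ultimately show ?thesis using g(2) by (intro exI[of _ g]) simp
qed

text \<open>The equation is solved on the whole space and \<open>V\<close> is then shown invariant:
  \<open>A t\<close> maps into the kernel \<open>V\<close> of \<open>Q\<close>, so \<open>Q\<close>
  is constant along solutions. Skewness conserves the norm of every solution, differences included,
  which gives uniqueness.\<close>

lemma skew_propagator_exists:
  fixes A :: "real \<Rightarrow> 'a::chilbert_space \<Rightarrow>\<^sub>L 'a" and Q :: "'a \<Rightarrow> 'a"
  assumes A: "continuous_on {a..b} A"
    and clin: "\<And>t c u. t \<in> {a..b} \<Longrightarrow> A t (c *\<^sub>C u) = c *\<^sub>C A t u"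
    and skew: "\<And>t u. t \<in> {a..b} \<Longrightarrow> inner u (A t u) = 0"
    and V: "csubspace V" and Q: "bounded_linear Q" "\<And>u. u \<in> V \<longleftrightarrow> Q u = 0"
    and QA: "\<And>t u. t \<in> {a..b} \<Longrightarrow> A t u \<in> V"
    and G: "\<And>t u. t \<in> {a..b} \<Longrightarrow> u \<in> V \<Longrightarrow> G t u = \<i> *\<^sub>C A t u"
  shows "\<exists>W. unitary_propagator {a..b} V V V G W"
proof -
  define I where "I = {a..b}"
  have convI: "convex I" by (simp add: I_def)
  define sol where "sol x \<longleftrightarrow> (\<forall>t\<in>I. (x has_vector_derivative A t (x t)) (at t within I))" for x
  \<comment> \<open>A solution is chosen separately for each initial datum, so linearity and the
    composition law have to be recovered from uniqueness.\<close>
  define W where "W t s u = (SOME x. x s = u \<and> sol x) t" for t s u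
  have W: "W s s u = u \<and> sol (\<lambda>t. W t s u)" if "s \<in> I" for s u
    using someI_ex[of "\<lambda>x. x s = u \<and> sol x"] linear_ode_exists[OF A, of s u] that
    unfolding W_def sol_def I_def by simp
  have norm_le: "norm (x t) \<le> norm (x s)" if "sol x" "s \<in> I" "t \<in> I" for x s t
    using energy_bound[of I 0 x "\<lambda>t. A t (x t)" s t] that skew convI by (simp add: sol_def I_def)
  have norm_eq: "norm (x t) = norm (x s)" if "sol x" "s \<in> I" "t \<in> I" for x s t
    using norm_le that by (meson antisym)
  have sol_diff: "sol (\<lambda>t. x t - y t)" if "sol x" "sol y" for x y
    using that by (auto simp: sol_def blinfun.diff_right intro!: has_vector_derivative_diff)
  have sol_add: "sol (\<lambda>t. x t + y t)" if "sol x" "sol y" for x y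
    using that by (auto simp: sol_def blinfun.add_right intro!: has_vector_derivative_add)
  have sol_scaleC: "sol (\<lambda>t. c *\<^sub>C x t)" if "sol x" for x c
    using that bounded_linear.has_vector_derivative[OF bounded_linear_scaleC[of c]]
    by (auto simp: sol_def clin I_def)
  have unique: "x t = y t" if "sol x" "sol y" "x r = y r" "r \<in> I" "t \<in> I" for x y r t
    using norm_le[OF sol_diff[OF that(1,2)] that(4,5)] that(3) by simp
  have W_add: "W t s (u + v) = W t s u + W t s v" if "t \<in> I" "s \<in> I" for t s u v
    using unique[of "\<lambda>t. W t s (u + v)" "\<lambda>t. W t s u + W t s v" s t] sol_add W that by simp
  have W_scaleC: "W t s (c *\<^sub>C u) = c *\<^sub>C W t s u" if "t \<in> I" "s \<in> I" for t s c u
    using unique[of "\<lambda>t. W t s (c *\<^sub>C u)" "\<lambda>t. c *\<^sub>C W t s u" s t] sol_scaleC W that by simp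
  have W_W: "W t r (W r s u) = W t s u" if "t \<in> I" "r \<in> I" "s \<in> I" for t r s u
    using unique[of "\<lambda>t. W t r (W r s u)" "\<lambda>t. W t s u" r t] W that by simp
  have W_norm: "norm (W t s u) = norm u" if "t \<in> I" "s \<in> I" for t s u
    using norm_eq[of "\<lambda>t. W t s u" s t] W that by simp
  have W_V: "W t s u \<in> V" if "t \<in> I" "s \<in> I" "u \<in> V" for t s u
  proof -
    have "norm (Q (W t s u)) \<le> norm (Q (W s s u)) + 0 * \<bar>t - s\<bar>"
    proof (rule energy_bound[OF convI, where e = "\<lambda>t. Q (W t s u)" and e' = "\<lambda>t. Q (A t (W t s u))"])
      show "((\<lambda>t. Q (W t s u)) has_vector_derivative Q (A \<tau> (W \<tau> s u))) (at \<tau> within I)" if "\<tau> \<in> I" for \<tau>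
        using W[OF \<open>s \<in> I\<close>] that bounded_linear.has_vector_derivative[OF Q(1)] by (auto simp: sol_def)
    qed (use QA Q(2) that I_def in auto)
    then show ?thesis using W[OF that(2)] that(3) Q(2) by simp
  qed
  \<comment> \<open>Polarisation of the conserved norm; commutation with \<open>\<i>\<close> later
    extends it to the complex form.\<close>
  have W_inner: "inner (W t s u) (W t s v) = inner u v" if "t \<in> I" "s \<in> I" for t s u v
    by (simp add: dot_norm W_add[OF that, symmetric] W_norm that)
  have "unitary_on V (W t s)" if "t \<in> I" "s \<in> I" for t s
    unfolding unitary_on_def clinear_on_def
  proof (intro conjI ballI allI V)
    show "W t s ` V = V"
    proof
      show "W t s ` V \<subseteq> V" using W_V that by blast
      show "V \<subseteq> W t s ` V"
      proof
        fix u assume "u \<in> V"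
        have "u = W t s (W s t u)" using W_W[of t s t u] W[of t u] that by simp
        then show "u \<in> W t s ` V" using W_V[OF that(2,1) \<open>u \<in> V\<close>] by blast
      qed
    qed
    show "cinner (W t s u) (W t s v) = cinner u v" for u v
      by (simp add: cinner_eq_Complex W_inner that W_scaleC[symmetric])
  qed (simp_all add: W_add W_scaleC that)
  moreover have "continuous_on (I \<times> I) (\<lambda>(t, s). W t s u)" for u
  proof -
    obtain M where M: "0 < M" "\<And>t. t \<in> I \<Longrightarrow> norm (A t) \<le> M"
      using compact_imp_bounded[OF compact_continuous_image[OF A compact_Icc]]
      unfolding bounded_pos I_def by auto
    have lip: "norm (W t s u - W t' s u) \<le> M * norm u * \<bar>t - t'\<bar>"
      if "t \<in> I" "t' \<in> I" "s \<in> I" for t t' s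
    proof -
      have "norm (W t s u - W t' s u) \<le> (M * norm u) * \<bar>t - t'\<bar> ^ Suc 0 / real (Suc 0)"
      proof (rule norm_diff_le_power)
        show "((\<lambda>t. W t s u) has_vector_derivative A \<tau> (W \<tau> s u)) (at \<tau> within {a..b})"
          if "\<tau> \<in> {a..b}" for \<tau>
          using W[OF \<open>s \<in> I\<close>] that by (simp add: sol_def I_def)
        show "norm (A \<tau> (W \<tau> s u)) \<le> M * norm u * \<bar>\<tau> - t'\<bar> ^ 0" if "\<tau> \<in> {a..b}" for \<tau>
          using norm_blinfun[of "A \<tau>" "W \<tau> s u"] mult_right_mono[OF M(2)[of \<tau>], of "norm u"]
            that \<open>s \<in> I\<close> by (simp add: W_norm I_def)
      qed (use that I_def in auto)
      then show ?thesis by simp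
    qed
    \<comment> \<open>The composition law turns a change of initial time into
      \<open>W t s (u - W s s' u)\<close>, and isometry reduces this to the Lipschitz bound in the
      first time.\<close>
    have lip2: "norm (W t s u - W t s' u) \<le> M * norm u * \<bar>s - s'\<bar>"
      if "t \<in> I" "s \<in> I" "s' \<in> I" for t s s'
    proof -
      have "W t s (- 1 *\<^sub>C W s s' u) = - 1 *\<^sub>C W t s (W s s' u)" by (rule W_scaleC[OF that(1,2)])
      then have "W t s u - W t s' u = W t s (u - W s s' u)"
        using W_add[OF that(1,2), of u "- W s s' u"] W_W[OF that(1,2,3), of u]
        by (simp add: scaleC_minus_left)
      then have "norm (W t s u - W t s' u) = norm (W s' s' u - W s s' u)"
        using W[OF that(3)] W_norm[OF that(1,2)] by simp
      also have "\<dots> \<le> M * norm u * \<bar>s' - s\<bar>" by (rule lip[OF that(3,2,3)])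
      finally show ?thesis by (simp add: abs_minus_commute)
    qed
    have "(2 * (M * norm u))-lipschitz_on (I \<times> I) (\<lambda>(t, s). W t s u)"
    proof (rule lipschitz_onI)
      fix p p' assume p: "p \<in> I \<times> I" "p' \<in> I \<times> I"
      obtain t s t' s' where ts: "p = (t, s)" "p' = (t', s')" by fastforce
      have "dist (W t s u) (W t' s' u) \<le> norm (W t s u - W t' s u) + norm (W t' s u - W t' s' u)"
        using dist_triangle[of "W t s u" "W t' s' u" "W t' s u"] by (simp add: dist_norm)
      also have "\<dots> \<le> M * norm u * \<bar>t - t'\<bar> + M * norm u * \<bar>s - s'\<bar>"
        using p ts by (intro add_mono lip lip2) auto
      also have "\<dots> \<le> M * norm u * dist p p' + M * norm u * dist p p'"
        using M(1) dist_fst_le[of p p'] dist_snd_le[of p p']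
        by (intro add_mono mult_left_mono) (auto simp: ts dist_real_def)
      finally show "dist (case p of (t, s) \<Rightarrow> W t s u) (case p' of (t, s) \<Rightarrow> W t s u)
          \<le> 2 * (M * norm u) * dist p p'" by (simp add: ts)
    qed (use M in simp)
    then show ?thesis by (rule lipschitz_on_continuous_on)
  qed
  moreover have "strong_solution I V G (\<lambda>t. W t s u)" if "s \<in> I" "u \<in> V" for s u
    unfolding strong_solution_def
  proof (intro ballI conjI)
    fix t assume t: "t \<in> I"
    show "W t s u \<in> V" by (rule W_V[OF t that])
    then show "\<exists>x'. ((\<lambda>t. W t s u) has_vector_derivative x') (at t within I) \<and> \<i> *\<^sub>C x' = G t (W t s u)"
      using W[OF that(1), of u] t G by (intro exI[of _ "A t (W t s u)"]) (auto simp: sol_def I_def)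
  qed
  ultimately have "unitary_propagator I V V V G W"
    unfolding unitary_propagator_def using W W_W by blast
  then show ?thesis unfolding I_def by blast
qed

section \<open>Operator norms\<close>

text \<open>Rescaling to the unit ball over which the supremum runs. One-sided homogeneity suffices:
  \<open>\<le>\<close> for the source norm, \<open>\<ge>\<close> for the target norm.\<close>

lemma op_norm_le_imp:
  assumes T: "\<And>c u. u \<in> S \<Longrightarrow> T (c *\<^sub>R u) = c *\<^sub>R T u"
    and S: "\<And>c u. u \<in> S \<Longrightarrow> c *\<^sub>R u \<in> S"
    and nS: "\<And>c u. u \<in> S \<Longrightarrow> nS (c *\<^sub>R u) \<le> \<bar>c\<bar> * nS u"
    and nT: "\<And>c u. u \<in> S \<Longrightarrow> \<bar>c\<bar> * nT (T u) \<le> nT (c *\<^sub>R T u)"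
    and u: "u \<in> S" "nS u > 0"
    and C: "op_norm S nS nT T \<le> ennreal C" "0 \<le> C"
  shows "nT (T u) \<le> C * nS u"
proof -
  define v where "v = inverse (nS u) *\<^sub>R u"
  have v: "v \<in> S" unfolding v_def using S u by blast
  have "nS v \<le> 1"
    using nS[of u "inverse (nS u)"] u by (simp add: v_def)
  with v have "ennreal (nT (T v)) \<le> op_norm S nS nT T"
    unfolding op_norm_def by (intro SUP_upper) auto
  then have "ennreal (nT (T v)) \<le> ennreal C" using C(1) by (rule order_trans)
  then have "nT (T v) \<le> C" using C(2) by (simp add: ennreal_le_iff)
  moreover have "inverse (nS u) * nT (T u) \<le> nT (T v)"
    using nT[OF u(1), of "inverse (nS u)"] u T[OF u(1)] by (simp add: v_def)
  ultimately have "inverse (nS u) * nT (T u) \<le> C" by simp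
  then show ?thesis using u(2) by (simp add: inverse_eq_divide divide_le_eq)
qed

lemma op_norm_triangle:
  "op_norm S nS norm T \<le> op_norm S nS norm (\<lambda>u. T u - R u) + op_norm S nS norm R"
  unfolding op_norm_def
proof (rule SUP_least)
  fix u assume u: "u \<in> {u \<in> S. nS u \<le> 1}"
  have "ennreal (norm (T u)) \<le> ennreal (norm (T u - R u) + norm (R u))"
    using norm_triangle_sub[of "T u" "R u"] by (intro ennreal_leI) (simp add: add.commute)
  also have "\<dots> = ennreal (norm (T u - R u)) + ennreal (norm (R u))" by simp
  also have "\<dots> \<le> (SUP u\<in>{u \<in> S. nS u \<le> 1}. ennreal (norm (T u - R u)))
      + (SUP u\<in>{u \<in> S. nS u \<le> 1}. ennreal (norm (R u)))"
    by (intro add_mono SUP_upper u)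
  finally show "ennreal (norm (T u)) \<le> (SUP u\<in>{u \<in> S. nS u \<le> 1}. ennreal (norm (T u - R u)))
      + (SUP u\<in>{u \<in> S. nS u \<le> 1}. ennreal (norm (R u)))" .
qed

text \<open>Boundedness holds near each point by the triangle inequality and survives gluing of
  adjacent intervals, so bisection makes it global. This yields the finiteness of
  \<open>C_H\<close>.\<close>

lemma op_norm_bounded_on_Icc:
  fixes H :: "real \<Rightarrow> 'a::complex_inner \<Rightarrow> 'a" and a b :: real
  assumes "a \<le> b"
    and fin: "\<And>t. t \<in> {a..b} \<Longrightarrow> op_norm S nS norm (H t) < \<infinity>"
    and cont: "\<And>t. t \<in> {a..b} \<Longrightarrow>
      ((\<lambda>s. op_norm S nS norm (\<lambda>u. H s u - H t u)) \<longlongrightarrow> 0) (at t within {a..b})"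
  shows "(SUP t\<in>{a..b}. op_norm S nS norm (H t)) < \<infinity>"
proof -
  \<comment> \<open>The intersection is there because the small intervals around a point in the
    bisection principle may protrude from \<open>{a..b}\<close>.\<close>
  define P where "P c d \<longleftrightarrow> (\<exists>C<\<infinity>. \<forall>t\<in>{c..d} \<inter> {a..b}. op_norm S nS norm (H t) \<le> C)" for c d
  have "P a b"
  proof (rule Bolzano[OF \<open>a \<le> b\<close>])
    fix x y z assume "P x y" "P y z"
    obtain C where C: "C < \<infinity>" "\<forall>t\<in>{x..y} \<inter> {a..b}. op_norm S nS norm (H t) \<le> C"
      using \<open>P x y\<close> by (auto simp: P_def)
    obtain C' where C': "C' < \<infinity>" "\<forall>t\<in>{y..z} \<inter> {a..b}. op_norm S nS norm (H t) \<le> C'"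
      using \<open>P y z\<close> by (auto simp: P_def)
    have "op_norm S nS norm (H t) \<le> max C C'" if "t \<in> {x..z} \<inter> {a..b}" for t
      using C(2) C'(2) that by (cases "t \<le> y") (auto simp: le_max_iff_disj)
    moreover have "max C C' < \<infinity>" using C(1) C'(1) by (simp add: max_def)
    ultimately show "P x z" unfolding P_def by blast
  next
    fix t assume "a \<le> t" "t \<le> b"
    then have t: "t \<in> {a..b}" by simp
    have "\<forall>\<^sub>F s in at t within {a..b}. op_norm S nS norm (\<lambda>u. H s u - H t u) < 1"
      using order_tendstoD(2)[OF cont[OF t], of 1] by simp
    then obtain d where d: "0 < d" "\<And>s. s \<in> {a..b} \<Longrightarrow> s \<noteq> t \<Longrightarrow> dist s t < d \<Longrightarrow>
        op_norm S nS norm (\<lambda>u. H s u - H t u) < 1"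
      unfolding eventually_at by blast
    have "op_norm S nS norm (H s) \<le> 1 + op_norm S nS norm (H t)" if "s \<in> {a..b}" "dist s t < d" for s
    proof (cases "s = t")
      case False
      have "op_norm S nS norm (H s) \<le> op_norm S nS norm (\<lambda>u. H s u - H t u) + op_norm S nS norm (H t)"
        by (rule op_norm_triangle)
      also have "\<dots> \<le> 1 + op_norm S nS norm (H t)"
        using d(2)[OF that(1) False that(2)] by (intro add_right_mono) simp
      finally show ?thesis .
    qed (simp add: le_add_same_cancel2)
    moreover have "1 + op_norm S nS norm (H t) < \<infinity>" using fin[OF t] by simp
    ultimately have "P c e" if "c \<le> t \<and> t \<le> e \<and> e - c < d" for c e
      unfolding P_def using that
      by (intro exI[of _ "1 + op_norm S nS norm (H t)"]) (auto simp: dist_real_def)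
    with d(1) show "\<exists>d>0. \<forall>c e. c \<le> t \<and> t \<le> e \<and> e - c < d \<longrightarrow> P c e" by blast
  qed
  then obtain C where "C < \<infinity>" "\<forall>t\<in>{a..b}. op_norm S nS norm (H t) \<le> C"
    by (auto simp: P_def)
  then show ?thesis using SUP_least[of "{a..b}" "\<lambda>t. op_norm S nS norm (H t)" C] by (simp add: le_less_trans)
qed

lemma clinear_on_scaleR: "clinear_on S T \<Longrightarrow> u \<in> S \<Longrightarrow> T (c *\<^sub>R u) = c *\<^sub>R T u"
  unfolding clinear_on_def by (metis scaleC_of_real)

lemma clinear_on_add: "clinear_on S T \<Longrightarrow> u \<in> S \<Longrightarrow> v \<in> S \<Longrightarrow> T (u + v) = T u + T v"
  by (simp add: clinear_on_def)

lemma clinear_on_diff: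
  assumes "clinear_on S T" "u \<in> S" "v \<in> S" shows "T (u - v) = T u - T v"
proof -
  have "T (u - v + v) = T (u - v) + T v"
    using assms by (intro clinear_on_add[OF assms(1)] csubspace_diff) (auto simp: clinear_on_def)
  then show ?thesis by simp
qed

section \<open>The Galerkin error\<close>

context positive_compact_resolvent
begin

text \<open>The upper bound for the factor \<open>inverse c\<close>. This direction is what a target
  norm needs in \<open>op_norm_le_imp\<close>.\<close>

lemma Hnorm_scaleR_ge:
  assumes "u \<in> X r" shows "\<bar>c\<bar> * nX r u \<le> nX r (c *\<^sub>R u)"
proof (cases "c = 0")
  case False
  have "nX r (inverse c *\<^sub>R (c *\<^sub>R u)) \<le> \<bar>inverse c\<bar> * nX r (c *\<^sub>R u)"
    by (rule Hnorm_scaleR_le[OF Hsp_scaleR[OF assms]])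
  then have "\<bar>c\<bar> * nX r u \<le> \<bar>c\<bar> * (\<bar>inverse c\<bar> * nX r (c *\<^sub>R u))"
    using False by (intro mult_left_mono) simp_all
  also have "\<bar>c\<bar> * (\<bar>inverse c\<bar> * nX r (c *\<^sub>R u)) = nX r (c *\<^sub>R u)"
    using False by (simp add: abs_inverse)
  finally show ?thesis .
qed (simp add: Hnorm_nonneg)

lemma Hnorm_zero [simp]: "nX r 0 = 0"
proof -
  have "0 \<in> X r" using Pr_scaleR[of _ 0 0] by (simp add: Hsp_def fcalc_dom_def)
  from Hnorm_scaleR_le[OF this, of 0] show ?thesis using Hnorm_nonneg[of r 0] by simp
qed

text \<open>\<open>norm_le_Hnorm\<close> makes the scale norm definite, which settles the case
  \<open>nX r u = 0\<close> that rescaling cannot reach.\<close>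

lemma op_norm_le_imp_Hsp:
  assumes T: "\<And>c u. u \<in> X r \<Longrightarrow> T (c *\<^sub>R u) = c *\<^sub>R T u"
    and C: "op_norm (X r) (nX r) nT T \<le> ennreal C" "0 \<le> C"
    and nT: "nT 0 = 0" "\<And>c u. u \<in> X r \<Longrightarrow> \<bar>c\<bar> * nT (T u) \<le> nT (c *\<^sub>R T u)"
    and u: "0 \<le> r" "u \<in> X r"
  shows "nT (T u) \<le> C * nX r u"
proof (cases "nX r u = 0")
  case True
  then have "u = 0" using norm_le_Hnorm[OF u] by simp
  then have "T u = 0" using T[OF u(2), of 0] by simp
  with True nT(1) show ?thesis by simp
next
  case False
  then have pos: "0 < nX r u" using Hnorm_nonneg[of r u] by simp
  show ?thesis
    by (rule op_norm_le_imp[OF T Hsp_scaleR Hnorm_scaleR_le nT(2) u(2) pos C])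
qed

text \<open>Kept general in \<open>T\<close> so as to apply both to \<open>H t\<close>, for
  boundedness of the compressed generator, and to \<open>H s - H t\<close>, for its norm
  continuity.\<close>

lemma galerkin_bound:
  assumes T: "\<And>c u. u \<in> X \<mu> \<Longrightarrow> T (c *\<^sub>R u) = c *\<^sub>R T u"
    and C: "op_norm (X \<mu>) (nX \<mu>) norm T \<le> ennreal C" "0 \<le> C"
    and "0 \<le> \<mu>" "0 \<le> N"
  shows "norm (P N (T (P N u))) \<le> C * (1 + N) powr \<mu> * norm u"
proof -
  have "norm (P N (T (P N u))) \<le> norm (T (P N u))" by (rule norm_P_le)
  also have "\<dots> \<le> C * nX \<mu> (P N u)"
    by (rule op_norm_le_imp_Hsp[OF T C]) (use assms P_Hsp in auto)
  also have "\<dots> \<le> C * ((1 + N) powr \<mu> * norm u)"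
    using assms by (intro mult_left_mono P_Hsp)
  finally show ?thesis by simp
qed

text \<open>\<open>P N u\<close> lies in the domain on which \<open>T\<close> is symmetric, so its
  quadratic form is real there. Multiplied by \<open>- \<i>\<close>, the compression is therefore
  skew for the real inner product.\<close>

lemma cinner_compressed_real:
  assumes "symmetric_on (X \<mu>) T" "0 \<le> \<mu>" "0 \<le> N"
  shows "Im (cinner u (P N (T (P N u)))) = 0"
proof -
  have "cinner (P N u) (T (P N u)) = cinner (T (P N u)) (P N u)"
    using assms P_Hsp(1)[OF assms(2,3), of u] by (simp add: symmetric_on_def)
  also have "\<dots> = cnj (cinner (P N u) (T (P N u)))" by (rule cinner_commute)
  finally have "Im (cinner (P N u) (T (P N u))) = 0"
    by (metis Reals_cnj_iff complex_is_Real_iff)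
  then show ?thesis by (simp add: P_symmetric)
qed

lemma galerkin_propagator_unitary:
  assumes "0 \<le> \<mu>" "0 \<le> N"
    and sym: "\<And>t. t \<in> {a..b} \<Longrightarrow> symmetric_on (X \<mu>) (H t)"
    and bnd: "\<And>t. t \<in> {a..b} \<Longrightarrow> bounded_op (X \<mu>) (nX \<mu>) norm (H t)"
    and cont: "\<And>t. t \<in> {a..b} \<Longrightarrow>
      ((\<lambda>s. op_norm (X \<mu>) (nX \<mu>) norm (\<lambda>u. H s u - H t u)) \<longlongrightarrow> 0) (at t within {a..b})"
  shows "unitary_propagator {a..b} (range (P N)) (range (P N)) (range (P N))
      (\<lambda>t u. P N (H t (P N u))) (galerkin_propagator D A {a..b} H N)"
proof -
  \<comment> \<open>The generator of the equation solved for the time derivative, hence the factor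
    \<open>- \<i>\<close>.\<close>
  define B where "B t u = - (\<i> *\<^sub>C P N (H t (P N u)))" for t u
  have lin: "clinear_on (X \<mu>) (H t)" if "t \<in> {a..b}" for t
    using bnd[OF that] by (simp add: bounded_op_def)
  have PX: "P N u \<in> X \<mu>" for u by (rule P_Hsp(1)[OF assms(1,2)])
  have bl: "bounded_linear (B t)" if t: "t \<in> {a..b}" for t
  proof -
    obtain C where C: "op_norm (X \<mu>) (nX \<mu>) norm (H t) = ennreal C" "0 \<le> C"
      using bnd[OF t] by (cases "op_norm (X \<mu>) (nX \<mu>) norm (H t)") (auto simp: bounded_op_def)
    show ?thesis
    proof (rule bounded_linear_intro[where K = "C * (1 + N) powr \<mu>"])
      show "norm (B t u) \<le> norm u * (C * (1 + N) powr \<mu>)" for u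
        using galerkin_bound[OF clinear_on_scaleR[OF lin[OF t]] _ C(2) assms(1,2), of u] C(1)
        by (simp add: B_def mult.commute)
    qed (simp_all add: B_def P_add P_scaleR clinear_on_add[OF lin[OF t] PX PX]
        clinear_on_scaleR[OF lin[OF t] PX] scaleC_add_right scaleC_scaleR_commute)
  qed
  define \<B> where "\<B> t = Blinfun (B t)" for t
  have B: "blinfun_apply (\<B> t) = B t" if "t \<in> {a..b}" for t
    unfolding \<B>_def by (rule bounded_linear_Blinfun_apply[OF bl[OF that]])
  have contB: "continuous_on {a..b} \<B>"
    unfolding continuous_on_def
  proof (intro ballI tendstoI)
    fix t e :: real assume t: "t \<in> {a..b}" and e: "0 < e"
    \<comment> \<open>Compression costs the factor \<open>(1 + N) powr \<mu>\<close>; this choice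
      leaves \<open>e / 2\<close>, and so a strict inequality.\<close>
    define d where "d = e / (2 * (1 + N) powr \<mu>)"
    have N: "0 < (1 + N) powr \<mu>" using assms(2) by simp
    have d: "0 < d" using e N by (simp add: d_def)
    have "\<forall>\<^sub>F s in at t within {a..b}. op_norm (X \<mu>) (nX \<mu>) norm (\<lambda>u. H s u - H t u) < ennreal d"
      using order_tendstoD(2)[OF cont[OF t], of "ennreal d"] d by simp
    moreover have "\<forall>\<^sub>F s in at t within {a..b}. s \<in> {a..b}"
      by (simp add: eventually_at_filter)
    ultimately show "\<forall>\<^sub>F s in at t within {a..b}. dist (\<B> s) (\<B> t) < e"
    proof eventually_elim
      case (elim s)
      have "norm (\<B> s - \<B> t) \<le> d * (1 + N) powr \<mu>"
      proof (rule norm_blinfun_bound)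
        fix u
        have "(\<B> s - \<B> t) u = - (\<i> *\<^sub>C P N (H s (P N u) - H t (P N u)))"
          using elim t by (simp add: blinfun.diff_left B B_def P_diff scaleC_diff_right)
        moreover have "norm (P N (H s (P N u) - H t (P N u))) \<le> d * (1 + N) powr \<mu> * norm u"
          by (rule galerkin_bound[where T = "\<lambda>u. H s u - H t u"])
             (use elim(1) assms(1,2) d in \<open>auto simp: clinear_on_scaleR[OF lin[OF t]]
               clinear_on_scaleR[OF lin[OF elim(2)]] scaleR_diff_right\<close>)
        ultimately show "norm ((\<B> s - \<B> t) u) \<le> d * (1 + N) powr \<mu> * norm u"
          by (simp only: norm_minus_cancel norm_i)
      qed (use d in simp)
      also have "\<dots> = e / 2" using N by (simp add: d_def)
      finally show ?case using e by (simp add: dist_norm)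
    qed
  qed
  \<comment> \<open>The range of the projection as the kernel of \<open>1 - P\<close>, the form in
    which \<open>skew_propagator_exists\<close> expects its invariant subspace.\<close>
  have V: "u \<in> range (P N) \<longleftrightarrow> u - P N u = 0" for u
    using P_P by (metis eq_iff_diff_eq_0 rangeE rangeI)
  have "\<exists>W. unitary_propagator {a..b} (range (P N)) (range (P N)) (range (P N))
      (\<lambda>t u. P N (H t (P N u))) W"
  proof (rule skew_propagator_exists[OF contB _ _ csubspace_range_P _ V])
    fix t assume t: "t \<in> {a..b}"
    show "\<B> t (c *\<^sub>C u) = c *\<^sub>C \<B> t u" for c u
      using lin[OF t] PX by (simp add: B[OF t] B_def P_scaleC clinear_on_def scaleC_minus_right
          scaleC_scaleC mult.commute)
    show "inner u (\<B> t u) = 0" for u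
      using cinner_compressed_real[OF sym[OF t] assms(1,2), of u]
      by (simp add: B[OF t] B_def Im_cinner inner_i_left)
    show "\<B> t u \<in> range (P N)" for u
    proof
      show "\<B> t u = P N ((- \<i>) *\<^sub>C H t (P N u))"
        unfolding P_scaleC by (simp add: B[OF t] B_def scaleC_minus_left)
    qed simp
    show "P N (H t (P N u)) = \<i> *\<^sub>C \<B> t u" for u
      by (simp add: B[OF t] B_def scaleC_minus_right)
  next
    show "bounded_linear (\<lambda>u. u - P N u)"
      by (intro bounded_linear_sub bounded_linear_ident bounded_linear_P)
  qed
  then show ?thesis
    unfolding galerkin_propagator_def Let_def by (rule someI_ex)
qed

text \<open>Real constants and an arbitrary propagator \<open>W\<close> keep the analysis free of
  extended reals and of the choice inside \<open>galerkin_propagator\<close>.\<close>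

lemma galerkin_error:
  assumes I: "I = {a..b}" and "0 \<le> \<mu>" "0 < \<sigma>" "0 < N"
    and sym: "\<And>t. t \<in> I \<Longrightarrow> symmetric_on (X \<mu>) (H t)"
    and lin: "\<And>t. t \<in> I \<Longrightarrow> clinear_on (X \<mu>) (H t)"
    and cH: "\<And>t. t \<in> I \<Longrightarrow> op_norm (X \<mu>) (nX \<mu>) norm (H t) \<le> ennreal cH" "0 \<le> cH"
    and W: "unitary_propagator I (range (P N)) (range (P N)) (range (P N)) (\<lambda>t u. P N (H t (P N u))) W"
    and U: "unitary_propagator I UNIV (X \<mu>) (X (\<mu> + \<sigma>)) H U"
    and UX: "\<And>t s. t \<in> I \<Longrightarrow> s \<in> I \<Longrightarrow> U t s ` X (\<mu> + \<sigma>) \<subseteq> X (\<mu> + \<sigma>)"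
    and cU: "\<And>t s. t \<in> I \<Longrightarrow> s \<in> I \<Longrightarrow> op_norm (X (\<mu> + \<sigma>)) (nX (\<mu> + \<sigma>)) (nX (\<mu> + \<sigma>)) (U t s) \<le> ennreal cU"
      "0 \<le> cU"
    and u: "u \<in> X (\<mu> + \<sigma>)" and ts: "t \<in> I" "s \<in> I"
  shows "norm (W t s (P N u) - U t s u)
    \<le> cU * ((1 + N) powr (- (\<mu> + \<sigma>)) + (b - a) * cH * (1 + N) powr (- \<sigma>)) * nX (\<mu> + \<sigma>) u"
proof -
  define v where "v \<tau> = U \<tau> s u" for \<tau>
  define w where "w \<tau> = W \<tau> s (P N u)" for \<tau>
  have "strong_solution I (X \<mu>) H v"
    using U u ts(2) unfolding v_def by (simp add: unitary_propagator_def)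
  then obtain v' where v: "\<And>\<tau>. \<tau> \<in> I \<Longrightarrow> v \<tau> \<in> X \<mu>"
    "\<And>\<tau>. \<tau> \<in> I \<Longrightarrow> (v has_vector_derivative v' \<tau>) (at \<tau> within I)"
    "\<And>\<tau>. \<tau> \<in> I \<Longrightarrow> \<i> *\<^sub>C v' \<tau> = H \<tau> (v \<tau>)"
    unfolding strong_solution_def by metis
  have "strong_solution I (range (P N)) (\<lambda>t u. P N (H t (P N u))) w"
    using W ts(2) unfolding w_def by (simp add: unitary_propagator_def)
  then obtain w' where w:
    "\<And>\<tau>. \<tau> \<in> I \<Longrightarrow> (w has_vector_derivative w' \<tau>) (at \<tau> within I)"
    "\<And>\<tau>. \<tau> \<in> I \<Longrightarrow> \<i> *\<^sub>C w' \<tau> = P N (H \<tau> (P N (w \<tau>)))"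
    unfolding strong_solution_def by metis
  have PX: "P N x \<in> X \<mu>" for x using P_Hsp(1) assms by simp
  have vX: "v \<tau> \<in> X (\<mu> + \<sigma>)" if "\<tau> \<in> I" for \<tau>
    using UX[OF that ts(2)] u by (auto simp: v_def)
  have vn: "nX (\<mu> + \<sigma>) (v \<tau>) \<le> cU * nX (\<mu> + \<sigma>) u" if "\<tau> \<in> I" for \<tau>
    unfolding v_def
  proof (rule op_norm_le_imp_Hsp[OF _ cU(1)[OF that ts(2)] cU(2)])
    show "U \<tau> s (c *\<^sub>R x) = c *\<^sub>R U \<tau> s x" for c x
      using U that ts(2) by (intro clinear_on_scaleR[of UNIV]) (auto simp: unitary_propagator_def unitary_on_def)
    show "\<bar>c\<bar> * nX (\<mu> + \<sigma>) (U \<tau> s x) \<le> nX (\<mu> + \<sigma>) (c *\<^sub>R U \<tau> s x)" if "x \<in> X (\<mu> + \<sigma>)" for c x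
      using UX[OF \<open>\<tau> \<in> I\<close> ts(2)] that by (intro Hnorm_scaleR_ge) auto
  qed (use assms in auto)
  define n where "n = nX (\<mu> + \<sigma>) u"
  \<comment> \<open>Bound on the residual: \<open>cH\<close> for the operator, the loss from
    \<open>\<mu> + \<sigma>\<close> to \<open>\<mu>\<close> for the tail, and \<open>cU * n\<close>
    for the regularity of \<open>v\<close>.\<close>
  define K where "K = cH * ((1 + N) powr (- \<sigma>) * (cU * n))"
  have K: "0 \<le> K" unfolding K_def n_def using cH(2) cU(2) Hnorm_nonneg by simp
  have QX: "v \<tau> - P N (v \<tau>) \<in> X \<mu>" if "\<tau> \<in> I" for \<tau>
    using Q_Hsp(1)[OF _ _ vX[OF that]] assms by simp
  have residual: "norm (P N (H \<tau> (v \<tau> - P N (v \<tau>)))) \<le> K" if \<tau>: "\<tau> \<in> I" for \<tau>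
  proof -
    have "norm (P N (H \<tau> (v \<tau> - P N (v \<tau>)))) \<le> norm (H \<tau> (v \<tau> - P N (v \<tau>)))" by (rule norm_P_le)
    also have "\<dots> \<le> cH * nX \<mu> (v \<tau> - P N (v \<tau>))"
      by (rule op_norm_le_imp_Hsp[OF clinear_on_scaleR[OF lin[OF \<tau>]] cH(1)[OF \<tau>] cH(2)])
         (use QX[OF \<tau>] assms in auto)
    also have "\<dots> \<le> cH * ((1 + N) powr (\<mu> - (\<mu> + \<sigma>)) * nX (\<mu> + \<sigma>) (v \<tau>))"
      using assms vX[OF \<tau>] by (intro mult_left_mono Q_Hsp(2)) auto
    also have "\<dots> \<le> cH * ((1 + N) powr (\<mu> - (\<mu> + \<sigma>)) * (cU * n))"
      using vn[OF \<tau>] cH(2) unfolding n_def by (intro mult_left_mono) auto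
    finally show ?thesis by (simp add: K_def)
  qed
  define e where "e \<tau> = P N (v \<tau>) - w \<tau>" for \<tau>
  have "norm (e t) \<le> norm (e s) + K * \<bar>t - s\<bar>"
  proof (rule energy_bound[OF _ K _ _ ts(2,1), where e' = "\<lambda>\<tau>. P N (v' \<tau>) - w' \<tau>"])
    fix \<tau> assume \<tau>: "\<tau> \<in> I"
    show "(e has_vector_derivative P N (v' \<tau>) - w' \<tau>) (at \<tau> within I)"
      unfolding e_def
      by (intro has_vector_derivative_diff w(1) \<tau>
          bounded_linear.has_vector_derivative[OF bounded_linear_P v(2)])
    \<comment> \<open>\<open>H \<tau>\<close> is linear only on \<open>X \<mu>\<close>, so the split
      needs both the tail and the projection of \<open>v \<tau>\<close> to lie there.\<close>
    have "H \<tau> (v \<tau>) = H \<tau> (v \<tau> - P N (v \<tau>)) + H \<tau> (P N (v \<tau>))"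
      using clinear_on_add[OF lin[OF \<tau>] QX[OF \<tau>] PX, of "v \<tau>"] by simp
    moreover have "H \<tau> (P N (e \<tau>)) = H \<tau> (P N (v \<tau>)) - H \<tau> (P N (w \<tau>))"
      unfolding e_def P_diff P_P by (rule clinear_on_diff[OF lin[OF \<tau>] PX PX])
    ultimately have eq: "\<i> *\<^sub>C (P N (v' \<tau>) - w' \<tau>)
        = P N (H \<tau> (v \<tau> - P N (v \<tau>))) + P N (H \<tau> (P N (e \<tau>)))"
      using v(3)[OF \<tau>] w(2)[OF \<tau>]
      by (simp add: scaleC_diff_right P_add P_diff flip: P_scaleC)
    \<comment> \<open>Multiplying both entries by \<open>\<i>\<close> preserves the real inner
      product and turns the compressed term into the imaginary part of its quadratic form, which is
      zero.\<close>
    have "inner (e \<tau>) (P N (v' \<tau>) - w' \<tau>) = inner (\<i> *\<^sub>C e \<tau>) (\<i> *\<^sub>C (P N (v' \<tau>) - w' \<tau>))"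
      by simp
    also have "\<dots> = inner (\<i> *\<^sub>C e \<tau>) (P N (H \<tau> (v \<tau> - P N (v \<tau>))))"
      using cinner_compressed_real[OF sym[OF \<tau>], of N "e \<tau>"] assms
      unfolding eq inner_add_right Im_cinner by simp
    finally have "\<bar>inner (e \<tau>) (P N (v' \<tau>) - w' \<tau>)\<bar>
        \<le> norm (\<i> *\<^sub>C e \<tau>) * norm (P N (H \<tau> (v \<tau> - P N (v \<tau>))))"
      using Cauchy_Schwarz_ineq2 by metis
    also have "\<dots> \<le> norm (e \<tau>) * K"
      using residual[OF \<tau>] by (simp add: mult_left_mono)
    finally show "\<bar>inner (e \<tau>) (P N (v' \<tau>) - w' \<tau>)\<bar> \<le> K * norm (e \<tau>)" by (simp add: mult.commute)
  qed (simp add: I)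
  also have "e s = 0"
    using U W ts(2) by (simp add: e_def v_def w_def unitary_propagator_def)
  also have "norm (0::'a) + K * \<bar>t - s\<bar> \<le> K * (b - a)"
    using ts I K by (auto intro!: mult_left_mono)
  finally have 1: "norm (e t) \<le> K * (b - a)" .
  have "nX 0 (v t - P N (v t)) \<le> (1 + N) powr (0 - (\<mu> + \<sigma>)) * nX (\<mu> + \<sigma>) (v t)"
    using assms vX[OF ts(1)] by (intro Q_Hsp(2)) auto
  also have "\<dots> \<le> (1 + N) powr (0 - (\<mu> + \<sigma>)) * (cU * n)"
    using vn[OF ts(1)] unfolding n_def by (intro mult_left_mono) auto
  finally have 2: "norm (v t - P N (v t)) \<le> (1 + N) powr (- (\<mu> + \<sigma>)) * (cU * n)"
    by (simp add: Hnorm_0)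
  have "norm (w t - v t) \<le> norm (e t) + norm (v t - P N (v t))"
    using norm_triangle_ineq[of "e t" "v t - P N (v t)"] by (simp add: e_def norm_minus_commute)
  also have "\<dots> \<le> K * (b - a) + (1 + N) powr (- (\<mu> + \<sigma>)) * (cU * n)"
    by (intro add_mono 1 2)
  also have "\<dots> = cU * ((1 + N) powr (- (\<mu> + \<sigma>)) + (b - a) * cH * (1 + N) powr (- \<sigma>)) * n"
    by (simp add: K_def algebra_simps)
  finally show ?thesis by (simp add: w_def v_def n_def)
qed

end

section \<open>From pointwise real bounds to suprema in the extended reals\<close>

theorem theorem3p14:
  fixes D\<^sub>0 :: "'h::chilbert_space set"
    and H\<^sub>0 :: "'h \<Rightarrow> 'h"
    and H :: "real \<Rightarrow> 'h \<Rightarrow> 'h"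
    and U :: "real \<Rightarrow> real \<Rightarrow> 'h \<Rightarrow> 'h"
    and a b \<mu> \<sigma> :: real
    and I :: "real set"
    and C_U C_H :: ennreal
  assumes "separable_space (euclidean :: 'h topology)"
    and "self_adjoint D\<^sub>0 H\<^sub>0" and "positive_on D\<^sub>0 H\<^sub>0" and "compact_resolvent D\<^sub>0 H\<^sub>0"
    and "a \<le> b" and "I = {a..b}"
    and "0 \<le> \<mu>"
    and "\<forall>t\<in>I. symmetric_on (Hsp D\<^sub>0 H\<^sub>0 \<mu>) (H t)"
    and "\<forall>t\<in>I. bounded_op (Hsp D\<^sub>0 H\<^sub>0 \<mu>) (Hnorm D\<^sub>0 H\<^sub>0 \<mu>) norm (H t)"
    and "\<forall>t\<in>I. ((\<lambda>s. op_norm (Hsp D\<^sub>0 H\<^sub>0 \<mu>) (Hnorm D\<^sub>0 H\<^sub>0 \<mu>) norm (\<lambda>u. H s u - H t u)) \<longlongrightarrow> 0)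
                  (at t within I)"
    and "0 < \<sigma>"
    and "unitary_propagator I UNIV (Hsp D\<^sub>0 H\<^sub>0 \<mu>) (Hsp D\<^sub>0 H\<^sub>0 (\<mu> + \<sigma>)) H U"
    and "\<forall>t\<in>I. \<forall>s\<in>I. U t s ` Hsp D\<^sub>0 H\<^sub>0 (\<mu> + \<sigma>) \<subseteq> Hsp D\<^sub>0 H\<^sub>0 (\<mu> + \<sigma>)"
    and "C_U = (SUP (t, s)\<in>I \<times> I. op_norm (Hsp D\<^sub>0 H\<^sub>0 (\<mu> + \<sigma>))
                  (Hnorm D\<^sub>0 H\<^sub>0 (\<mu> + \<sigma>)) (Hnorm D\<^sub>0 H\<^sub>0 (\<mu> + \<sigma>)) (U t s))"
    and "C_U < \<infinity>"
    and "C_H = (SUP t\<in>I. op_norm (Hsp D\<^sub>0 H\<^sub>0 \<mu>) (Hnorm D\<^sub>0 H\<^sub>0 \<mu>) norm (H t))"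
  shows "(\<forall>N>0. \<forall>u\<in>Hsp D\<^sub>0 H\<^sub>0 (\<mu> + \<sigma>).
            (SUP (t, s)\<in>I \<times> I.
               ennreal (norm (galerkin_propagator D\<^sub>0 H\<^sub>0 I H N t s (spec_proj D\<^sub>0 H\<^sub>0 N u) - U t s u)))
            \<le> C_U * (ennreal ((1 + N) powr (- (\<mu> + \<sigma>)))
                      + ennreal (b - a) * C_H * ennreal ((1 + N) powr (- \<sigma>)))
                * ennreal (Hnorm D\<^sub>0 H\<^sub>0 (\<mu> + \<sigma>) u))
       \<and> (\<exists>C>0. \<forall>N>0. \<forall>u\<in>Hsp D\<^sub>0 H\<^sub>0 (\<mu> + \<sigma>).
            (SUP (t, s)\<in>I \<times> I.
               ennreal (norm (galerkin_propagator D\<^sub>0 H\<^sub>0 I H N t s (spec_proj D\<^sub>0 H\<^sub>0 N u) - U t s u)))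
            \<le> ennreal (C * (1 + N) powr (- \<sigma>) * Hnorm D\<^sub>0 H\<^sub>0 (\<mu> + \<sigma>) u))"
proof -
  let ?X = "Hsp D\<^sub>0 H\<^sub>0" and ?n = "Hnorm D\<^sub>0 H\<^sub>0" and ?P = "spec_proj D\<^sub>0 H\<^sub>0"
  interpret positive_compact_resolvent D\<^sub>0 H\<^sub>0
    using assms(2-4) by unfold_locales
  \<comment> \<open>Finiteness comes from norm continuity on a compact interval; it permits the
    passage to a real constant.\<close>
  have "C_H < \<infinity>"
    unfolding assms(16) \<open>I = {a..b}\<close>
    using assms(9,10) \<open>I = {a..b}\<close> by (intro op_norm_bounded_on_Icc \<open>a \<le> b\<close>) (auto simp: bounded_op_def)
  then obtain cH where cH: "C_H = ennreal cH" "0 \<le> cH" by (cases C_H) auto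
  obtain cU where cU: "C_U = ennreal cU" "0 \<le> cU" using \<open>C_U < \<infinity>\<close> by (cases C_U) auto
  have opH: "op_norm (?X \<mu>) (?n \<mu>) norm (H t) \<le> ennreal cH" if "t \<in> I" for t
    unfolding cH(1)[symmetric] assms(16) by (rule SUP_upper[OF that])
  have opU: "op_norm (?X (\<mu> + \<sigma>)) (?n (\<mu> + \<sigma>)) (?n (\<mu> + \<sigma>)) (U t s) \<le> ennreal cU"
    if "t \<in> I" "s \<in> I" for t s
    unfolding cU(1)[symmetric] assms(14)
    using SUP_upper[of "(t, s)" "I \<times> I" "\<lambda>(t, s). op_norm (?X (\<mu> + \<sigma>)) (?n (\<mu> + \<sigma>)) (?n (\<mu> + \<sigma>)) (U t s)"]
      that by simp
  define err where "err N u = (SUP (t, s)\<in>I \<times> I.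
      ennreal (norm (galerkin_propagator D\<^sub>0 H\<^sub>0 I H N t s (?P N u) - U t s u)))" for N u
  define c where "c N = cU * ((1 + N) powr (- (\<mu> + \<sigma>)) + (b - a) * cH * (1 + N) powr (- \<sigma>))" for N
  have err: "err N u \<le> ennreal (c N * ?n (\<mu> + \<sigma>) u)" if "0 < N" "u \<in> ?X (\<mu> + \<sigma>)" for N u
    unfolding err_def
  proof (rule SUP_least, clarify)
    fix t s assume ts: "t \<in> I" "s \<in> I"
    have W: "unitary_propagator I (range (?P N)) (range (?P N)) (range (?P N))
        (\<lambda>t u. ?P N (H t (?P N u))) (galerkin_propagator D\<^sub>0 H\<^sub>0 I H N)"
      unfolding \<open>I = {a..b}\<close>
      by (rule galerkin_propagator_unitary[of \<mu>]) (use assms that in auto)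
    show "ennreal (norm (galerkin_propagator D\<^sub>0 H\<^sub>0 I H N t s (?P N u) - U t s u))
        \<le> ennreal (c N * ?n (\<mu> + \<sigma>) u)"
      unfolding c_def
      by (intro ennreal_leI galerkin_error[OF \<open>I = {a..b}\<close> _ _ _ _ _ opH cH(2) W _ _ opU cU(2)])
         (use assms(7,8,9,11,12,13) that ts in \<open>auto simp: bounded_op_def\<close>)
  qed
  have "err N u \<le> C_U * (ennreal ((1 + N) powr (- (\<mu> + \<sigma>)))
      + ennreal (b - a) * C_H * ennreal ((1 + N) powr (- \<sigma>))) * ennreal (?n (\<mu> + \<sigma>) u)"
    if "0 < N" "u \<in> ?X (\<mu> + \<sigma>)" for N u
  proof -
    \<comment> \<open>\<open>ennreal\<close> truncates negative numbers and is multiplicative only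
      on nonnegative ones.\<close>
    have "0 \<le> b - a" using \<open>a \<le> b\<close> by simp
    then have "ennreal (c N * ?n (\<mu> + \<sigma>) u) = C_U * (ennreal ((1 + N) powr (- (\<mu> + \<sigma>)))
      + ennreal (b - a) * C_H * ennreal ((1 + N) powr (- \<sigma>))) * ennreal (?n (\<mu> + \<sigma>) u)"
      using cH(2) cU(2) unfolding c_def cH(1) cU(1)
      by (simp add: ennreal_mult Hnorm_nonneg)
    with err[OF that] show ?thesis by simp
  qed
  moreover have "\<exists>C>0. \<forall>N>0. \<forall>u\<in>?X (\<mu> + \<sigma>).
      err N u \<le> ennreal (C * (1 + N) powr (- \<sigma>) * ?n (\<mu> + \<sigma>) u)"
  \<comment> \<open>Since \<open>\<mu>\<close> is nonnegative, both powers are at most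
    \<open>(1 + N) powr (- \<sigma>)\<close>, which leaves \<open>cU * (1 + (b - a) * cH)\<close>;
    the added 1 makes the constant positive even if \<open>cU\<close> is 0.\<close>
  proof (intro exI[of _ "cU * (1 + (b - a) * cH) + 1"] conjI allI impI ballI)
    show "0 < cU * (1 + (b - a) * cH) + 1"
      using cU(2) cH(2) \<open>a \<le> b\<close> by (intro add_nonneg_pos mult_nonneg_nonneg add_nonneg_nonneg) auto
    fix N :: real and u assume N: "0 < N" and u: "u \<in> ?X (\<mu> + \<sigma>)"
    have "(1 + N) powr (- (\<mu> + \<sigma>)) \<le> (1 + N) powr (- \<sigma>)"
      using N \<open>0 \<le> \<mu>\<close> by (intro powr_mono) auto
    then have "c N \<le> cU * ((1 + N) powr (- \<sigma>) + (b - a) * cH * (1 + N) powr (- \<sigma>))"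
      unfolding c_def using cU(2) by (intro mult_left_mono add_right_mono)
    also have "\<dots> \<le> (cU * (1 + (b - a) * cH) + 1) * (1 + N) powr (- \<sigma>)"
      by (simp add: algebra_simps)
    finally have "c N * ?n (\<mu> + \<sigma>) u
        \<le> (cU * (1 + (b - a) * cH) + 1) * (1 + N) powr (- \<sigma>) * ?n (\<mu> + \<sigma>) u"
      using Hnorm_nonneg by (rule mult_right_mono)
    then show "err N u \<le> ennreal ((cU * (1 + (b - a) * cH) + 1) * (1 + N) powr (- \<sigma>) * ?n (\<mu> + \<sigma>) u)"
      by (intro order_trans[OF err[OF N u]] ennreal_leI)
  qed
  ultimately show ?thesis unfolding err_def by blast
qed

end
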